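(* Let $K$ be a complete algebraically closed non-Archimedean field. Let $f\in K[[x]]$ have a linearization disc $\Delta$ about an indifferent fixed point (placed at the origin, so $f(x)=\lambda x+\sum_{i\ge 2}a_ix^i$ with $|\lambda|=1$, $\lambda$ not a root of unity). Suppose that $\Delta$ is rational open, i.e. $\Delta=D_r(0)$ for some $r\in|K^*|$, and that the radius of the corresponding semi-disc of $f$ is strictly greater than $r$. Then $f$ has an indifferent periodic point on the boundary of $\Delta$, i.e. on the sphere $S_r(0)$.
   Context: A non-Archimedean field is a field with a nontrivial absolute value $|\cdot|$ satisfying $|x+y|\le\max(|x|,|y|)$. $D_r(0)=\{x\in K:|x|<r\}$ and $S_r(0)=\{x\in K:|x|=r\}$. Rational open means that $r$ lies in the value group $|K^*|=\{|x|:x\in K^*\}$; the boundary of the disc $D_r(0)$ means the sphere $S_r(0)$ (not the topological boundary). The conjugacy function $g$ of $f$ is the unique formal power series solution, with $g(0)=0$ and $g'(0)=1$, of the Schröder functional equation $g\circ f(x)=\lambda g(x)$, where $\lambda=f'(0)$. When $g$ has positive radius of convergence: the semi-disc of $f$ is the maximal disc $V$ about the origin such that the semi-conjugacy $g(f(x))=\lambda g(x)$ holds for all $x\in V$; the linearization disc $\Delta$ is the maximal disc $U$ about the origin such that the full conjugacy $g\circ f\circ g^{-1}(x)=\lambda x$ holds for all $x\in U$ (meaning that $g$ converges and is one-to-one on $U$, the compositional inverse power series $g^{-1}$ converges on $U$, and $g(f(g^{-1}(x)))=\lambda x$ for all $x\in U$). A periodic point $\hat x$ of period $\kappa$ is indifferent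 if $|(f^{\circ\kappa})'(\hat x)|=1$. *)

theory Defs
  imports "HOL-Analysis.Analysis" "HOL-Computational_Algebra.Computational_Algebra"
begin

text \<open>
  A field with a nontrivial non-Archimedean absolute value. Nonnegativity of \<open>absval\<close> and
  \<open>absval x = 0 \<longleftrightarrow> x = 0\<close> are inherited from the metric \<open>dist x y = absval (x - y)\<close>.
  Completeness is the class \<open>complete_space\<close>. (The library reserves \<open>norm\<close> for real normed
  vector spaces, and a norm on a real normed algebra is Archimedean.)
\<close>

class nonarch_field = field + metric_space +
  fixes absval :: "'a \<Rightarrow> real"
  assumes dist_absval: "dist x y = absval (x - y)"
    and absval_mult: "absval (x * y) = absval x * absval y"
    and absval_add: "absval (x + y) \<le> max (absval x) (absval y)"
    and absval_nontrivial: "\<exists>x. x \<noteq> 0 \<and> absval x \<noteq> 1"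

definition value_group :: "'a::nonarch_field itself \<Rightarrow> real set" where
  "value_group _ = {absval x | x :: 'a. x \<noteq> 0}"

text \<open>
  \<open>eval_fps\<close> of the library requires a real Banach algebra, whence the following.
  \<open>fps_at F x\<close> is meaningful only if \<open>fps_converges F x\<close>.
\<close>

definition fps_converges :: "'a::nonarch_field fps \<Rightarrow> 'a \<Rightarrow> bool" where
  "fps_converges F x \<longleftrightarrow> summable (\<lambda>n. fps_nth F n * x ^ n)"

definition fps_at :: "'a::nonarch_field fps \<Rightarrow> 'a \<Rightarrow> 'a" where
  "fps_at F x = (\<Sum>n. fps_nth F n * x ^ n)"

definition is_conjugacy_fps :: "'a::field fps \<Rightarrow> 'a fps \<Rightarrow> bool" where
  "is_conjugacy_fps f g \<longleftrightarrow>
     fps_nth g 0 = 0 \<and> fps_nth g 1 = 1 \<and> g oo f = fps_const (fps_nth f 1) * g"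

definition conjugacy_fps :: "'a::field fps \<Rightarrow> 'a fps" where
  "conjugacy_fps f = (THE g. is_conjugacy_fps f g)"

text \<open>
  Since \<open>f\<close> has no constant term, the coefficient of \<open>x\<^sup>n\<close> in the Schroeder equation
  determines \<open>g\<^sub>n\<close> from its predecessors, up to division by \<open>\<lambda> - \<lambda>\<^sup>n\<close>.
\<close>

fun conjugacy_coeff :: "'a::field fps \<Rightarrow> nat \<Rightarrow> 'a" where
  "conjugacy_coeff f n =
     (if n = 0 then 0 else if n = 1 then 1 else
       (\<Sum>i<n. conjugacy_coeff f i * fps_nth (f ^ i) n) / (fps_nth f 1 - fps_nth f 1 ^ n))"

declare conjugacy_coeff.simps [simp del]

lemma Schroeder_iff:
  fixes f g :: "'a::field fps"
  assumes "fps_nth f 0 = 0"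
  shows "g oo f = fps_const (fps_nth f 1) * g \<longleftrightarrow>
    (\<forall>n. (\<Sum>i<n. fps_nth g i * fps_nth (f ^ i) n) =
       (fps_nth f 1 - fps_nth f 1 ^ n) * fps_nth g n)"
proof -
  have "fps_nth (g oo f) n =
      (\<Sum>i<n. fps_nth g i * fps_nth (f ^ i) n) + fps_nth g n * fps_nth f 1 ^ n" for n
    using startsby_zero_power_nth_same [OF assms, of n]
    by (simp add: fps_compose_nth atLeast0AtMost flip: lessThan_Suc_atMost)
  then show ?thesis
    by (auto simp: fps_eq_iff algebra_simps)
qed

lemma ex1_conjugacy_fps:
  fixes f :: "'a::field fps"
  assumes f0: "fps_nth f 0 = 0"
    and nz: "fps_nth f 1 \<noteq> 0"
    and nr: "\<And>n::nat. n > 0 \<Longrightarrow> fps_nth f 1 ^ n \<noteq> 1"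
  shows "\<exists>!g. is_conjugacy_fps f g"
proof (rule ex1I)
  have ne: "fps_nth f 1 - fps_nth f 1 ^ n \<noteq> 0" if n: "n \<ge> 2" for n
  proof -
    obtain m where "n = Suc m" "m > 0" using n by (cases n) auto
    then show ?thesis using nz nr [of m] by auto
  qed
  show "is_conjugacy_fps f (Abs_fps (conjugacy_coeff f))"
    unfolding is_conjugacy_fps_def Schroeder_iff [OF f0]
  proof (intro conjI allI)
    fix n :: nat
    consider "n = 0" | "n = 1" | "n \<ge> 2" by linarith
    then show "(\<Sum>i<n. fps_nth (Abs_fps (conjugacy_coeff f)) i * fps_nth (f ^ i) n) =
      (fps_nth f 1 - fps_nth f 1 ^ n) * fps_nth (Abs_fps (conjugacy_coeff f)) n"
    proof cases
      case 3
      then show ?thesis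
        using ne [OF 3] by (simp add: conjugacy_coeff.simps [of f n])
    qed (auto simp: conjugacy_coeff.simps [of f 0])
  qed (simp_all add: conjugacy_coeff.simps)
  fix g assume g: "is_conjugacy_fps f g"
  have "fps_nth g n = conjugacy_coeff f n" for n :: nat
  proof (induction n rule: less_induct)
    case (less n)
    consider "n = 0" | "n = 1" | "n \<ge> 2" by linarith
    then show ?case
    proof cases
      case 3
      have "(\<Sum>i<n. fps_nth g i * fps_nth (f ^ i) n) =
          (fps_nth f 1 - fps_nth f 1 ^ n) * fps_nth g n"
        using g Schroeder_iff [OF f0, of g] unfolding is_conjugacy_fps_def by blast
      then show ?thesis
        using ne [OF 3] 3 less by (simp add: conjugacy_coeff.simps [of f n] field_simps)
    qed (use g in \<open>auto simp: is_conjugacy_fps_def conjugacy_coeff.simps\<close>)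
  qed
  then show "g = Abs_fps (conjugacy_coeff f)"
    by (simp add: fps_eq_iff)
qed

text \<open>
  Discs about the origin, open or closed, with a positive and possibly infinite radius.
  Over an algebraically closed field the value group is dense, so the radius of a disc
  is unique.
\<close>

definition disc_of_radius :: "'a::nonarch_field set \<Rightarrow> ereal \<Rightarrow> bool" where
  "disc_of_radius U R \<longleftrightarrow>
     (\<exists>\<rho>>0. R = ereal \<rho> \<and> (U = ball 0 \<rho> \<or> U = cball 0 \<rho>)) \<or> (R = \<infinity> \<and> U = UNIV)"

definition is_maximal_disc :: "('a::nonarch_field set \<Rightarrow> bool) \<Rightarrow> 'a set \<Rightarrow> bool" where
  "is_maximal_disc P U \<longleftrightarrow>
     (\<exists>R. disc_of_radius U R) \<and> P U \<and> (\<forall>W R. disc_of_radius W R \<and> P W \<longrightarrow> W \<subseteq> U)"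

definition semi_conjugacy_on :: "'a::nonarch_field fps \<Rightarrow> 'a set \<Rightarrow> bool" where
  "semi_conjugacy_on f V \<longleftrightarrow> (let g = conjugacy_fps f in
     \<forall>x\<in>V. fps_converges f x \<and> fps_converges g (fps_at f x) \<and> fps_converges g x \<and>
       fps_at g (fps_at f x) = fps_nth f 1 * fps_at g x)"

definition full_conjugacy_on :: "'a::nonarch_field fps \<Rightarrow> 'a set \<Rightarrow> bool" where
  "full_conjugacy_on f U \<longleftrightarrow> (let g = conjugacy_fps f; h = fps_inv g in
     (\<forall>x\<in>U. fps_converges g x) \<and> inj_on (fps_at g) U \<and>
     (\<forall>x\<in>U. fps_converges h x \<and> fps_converges f (fps_at h x) \<and>
       fps_converges g (fps_at f (fps_at h x)) \<and>
       fps_at g (fps_at f (fps_at h x)) = fps_nth f 1 * x))"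

definition is_semi_disc :: "'a::nonarch_field fps \<Rightarrow> 'a set \<Rightarrow> bool" where
  "is_semi_disc f V \<longleftrightarrow> is_maximal_disc (semi_conjugacy_on f) V"

definition is_linearization_disc :: "'a::nonarch_field fps \<Rightarrow> 'a set \<Rightarrow> bool" where
  "is_linearization_disc f U \<longleftrightarrow> is_maximal_disc (full_conjugacy_on f) U"

definition has_nonarch_derivative :: "('a::nonarch_field \<Rightarrow> 'a) \<Rightarrow> 'a \<Rightarrow> 'a \<Rightarrow> bool" where
  "has_nonarch_derivative F d x \<longleftrightarrow> ((\<lambda>y. (F y - F x) / (y - x)) \<longlongrightarrow> d) (at x)"

text \<open>The period is the least one; the series has to converge along the whole orbit.\<close>

definition periodic_point_of_period :: "'a::nonarch_field fps \<Rightarrow> 'a \<Rightarrow> nat \<Rightarrow> bool" where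
  "periodic_point_of_period f x \<kappa> \<longleftrightarrow>
     \<kappa> > 0 \<and> (\<forall>i<\<kappa>. fps_converges f ((fps_at f ^^ i) x)) \<and>
     (fps_at f ^^ \<kappa>) x = x \<and> (\<forall>i. 0 < i \<and> i < \<kappa> \<longrightarrow> (fps_at f ^^ i) x \<noteq> x)"

definition indifferent_periodic_point :: "'a::nonarch_field fps \<Rightarrow> 'a \<Rightarrow> bool" where
  "indifferent_periodic_point f x \<longleftrightarrow>
     (\<exists>\<kappa> d. periodic_point_of_period f x \<kappa> \<and>
        has_nonarch_derivative (fps_at f ^^ \<kappa>) d x \<and> absval d = 1)"

end

theory Submission
  imports Defs
begin

text \<open>
  Let \<open>g\<close> be the conjugacy series and \<open>\<lambda>\<close> the multiplier at the origin. As the semi-disc is larger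
  than \<open>\<Delta>\<close>, both \<open>f\<close> and \<open>g\<close> converge on the closed disc of radius \<open>r\<close>, and \<open>g (f x) = \<lambda> g x\<close>
  holds there. It turns out that every zero of \<open>g\<close> on the sphere of radius \<open>r\<close> is an
  indifferent periodic point of \<open>f\<close>.

  Such zeros exist because \<open>\<Delta>\<close> is maximal. Over an algebraically closed field, a series in which
  some later term weighs at least as much as the constant term has a zero in the closed disc (\<open>ex_zero\<close>). So if \<open>g\<close>
  had no zero besides the origin in the closed disc, its linear term would strictly dominate all
  others there, \<open>g\<close> would be a small perturbation of the identity, its inverse series would
  converge on the whole closed disc by a contraction argument (\<open>tate_fps_inv\<close>), and \<open>f\<close> would
  be linearized on the closed disc (\<open>full_conjugacy_on_cball\<close>). That disc is larger than \<open>\<Delta>\<close>,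
  since \<open>r\<close> is a value of the field. As \<open>g\<close> is injective on \<open>\<Delta>\<close>, the additional zero lies on
  the sphere.

  The set \<open>Z\<close> of zeros of \<open>g\<close> on the sphere is finite (\<open>finite_zeros\<close>). Every point of the sphere
  has a preimage under \<open>f\<close> on the sphere (\<open>sphere_subset_image\<close>), and a preimage of a zero
  of \<open>g\<close> is a zero of \<open>g\<close> by the semi-conjugacy; so \<open>Z \<subseteq> f ` Z\<close>. A finite set that is covered by
  its own image is permuted, hence every point of \<open>Z\<close> is periodic. Arguing with preimages is
  essential: that \<open>f\<close> maps \<open>Z\<close> into the sphere is a consequence, because a priori \<open>f\<close> could send
  a zero of \<open>g\<close> on the sphere to the origin.

  Such a point \<open>z\<close>, of period \<open>\<kappa>\<close>, is indifferent: write \<open>g y = (y - z) ^ m * u y\<close> with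
  \<open>u z \<noteq> 0\<close> and compare the leading terms at \<open>z\<close> of the two sides of
  \<open>g ((f ^^ \<kappa>) y) = \<lambda> ^ \<kappa> * g y\<close>. The derivative \<open>d\<close> of \<open>f ^^ \<kappa>\<close> at \<open>z\<close> satisfies
  \<open>d ^ m = \<lambda> ^ \<kappa>\<close>, whence \<open>absval d = 1\<close> (\<open>multiplier_of_conjugacy_zero\<close>).
\<close>

section \<open>Ultrametric absolute values\<close>

lemma absval_nonneg [simp]: "0 \<le> absval (x::'a::nonarch_field)"
  using dist_absval [of x 0] zero_le_dist [of x 0] by simp

lemma absval_eq_0_iff [simp]: "absval x = 0 \<longleftrightarrow> x = (0::'a::nonarch_field)"
  using dist_absval [of x 0] dist_eq_0_iff [of x 0] by simp

lemma absval_zero [simp]: "absval (0::'a::nonarch_field) = 0"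
  by (simp only: absval_eq_0_iff)

lemma absval_pos_iff [simp]: "0 < absval x \<longleftrightarrow> x \<noteq> (0::'a::nonarch_field)"
  using absval_nonneg [of x] absval_eq_0_iff [of x] by linarith

lemma absval_one [simp]: "absval (1::'a::nonarch_field) = 1"
  using absval_mult [of 1 "1::'a"] by simp

lemma absval_power: "absval (x ^ n) = absval (x::'a::nonarch_field) ^ n"
  by (induction n) (simp_all add: absval_mult)

lemma absval_minus_commute: "absval (x - y) = absval (y - x :: 'a::nonarch_field)"
  by (metis dist_absval dist_commute)

lemma absval_minus [simp]: "absval (- x) = absval (x::'a::nonarch_field)"
  using absval_minus_commute [of 0 x] by simp

lemma absval_diff: "absval (x - y) \<le> max (absval x) (absval (y::'a::nonarch_field))"
  using absval_add [of x "- y"] by simp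

lemma absval_add_le:
  "absval x \<le> M \<Longrightarrow> absval y \<le> M \<Longrightarrow> absval (x + y :: 'a::nonarch_field) \<le> M"
  using absval_add [of x y] by linarith

lemma absval_diff_le:
  "absval x \<le> M \<Longrightarrow> absval y \<le> M \<Longrightarrow> absval (x - y :: 'a::nonarch_field) \<le> M"
  using absval_diff [of x y] by linarith

lemma absval_sum_le:
  assumes "0 \<le> M" "\<And>i. i \<in> A \<Longrightarrow> absval (F i) \<le> M"
  shows "absval (sum F A :: 'a::nonarch_field) \<le> M"
  using assms(2)
proof (induction A rule: infinite_finite_induct)
  case (insert a A)
  then show ?case by (auto intro: absval_add_le)
qed (use assms(1) in auto)

lemma absval_sum_less:
  assumes "0 < M" "\<And>i. i \<in> A \<Longrightarrow> absval (F i) < M"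
  shows "absval (sum F A :: 'a::nonarch_field) < M"
  using assms(2)
proof (induction A rule: infinite_finite_induct)
  case (insert a A)
  then have "absval (F a) < M" "absval (sum F A) < M" by auto
  then show ?case using insert.hyps absval_add [of "F a" "sum F A"] by auto
qed (use assms(1) in auto)

lemma absval_add_eq_left:
  assumes "absval y < absval (x::'a::nonarch_field)"
  shows "absval (x + y) = absval x"
  using absval_add [of x y] absval_diff [of "x + y" y] assms by auto

lemma absval_of_nat_le_one: "absval (of_nat n :: 'a::nonarch_field) \<le> 1"
proof (induction n)
  case (Suc n)
  then show ?case using absval_add_le [of 1 1 "of_nat n :: 'a"] by simp
qed simp

lemma mem_cball_0_iff: "x \<in> cball 0 r \<longleftrightarrow> absval (x::'a::nonarch_field) \<le> r"
  by (simp add: dist_absval)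

lemma mem_ball_0_iff: "x \<in> ball 0 r \<longleftrightarrow> absval (x::'a::nonarch_field) < r"
  by (simp add: dist_absval)

lemma mem_sphere_0_iff: "x \<in> sphere 0 r \<longleftrightarrow> absval (x::'a::nonarch_field) = r"
  by (simp add: dist_absval)

lemma tendsto_absval_iff:
  "(F \<longlongrightarrow> l) G \<longleftrightarrow> ((\<lambda>y. absval (F y - l :: 'a::nonarch_field)) \<longlongrightarrow> 0) G"
  by (subst tendsto_dist_iff) (simp add: dist_absval)

text \<open>
  With this instance and the next two, the general rules for limits of sums, products and powers
  apply.
\<close>

instance nonarch_field \<subseteq> topological_ab_group_add
proof
  show "((\<lambda>x. fst x + snd x) \<longlongrightarrow> a + b) (nhds a \<times>\<^sub>F nhds b)" for a b :: 'a
  proof -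
    have 1: "((\<lambda>x. absval (fst x - a)) \<longlongrightarrow> 0) (nhds a \<times>\<^sub>F nhds b)"
      using filterlim_fst [of "nhds a" "nhds b"] by (simp flip: tendsto_absval_iff)
    have 2: "((\<lambda>x. absval (snd x - b)) \<longlongrightarrow> 0) (nhds a \<times>\<^sub>F nhds b)"
      using filterlim_snd [of "nhds b" "nhds a"] by (simp flip: tendsto_absval_iff)
    have "absval (fst x + snd x - (a + b)) \<le> absval (fst x - a) + absval (snd x - b)" for x
    proof -
      have "fst x + snd x - (a + b) = (fst x - a) + (snd x - b)" by simp
      then show ?thesis by (metis absval_add_le absval_nonneg le_add_same_cancel1 le_add_same_cancel2)
    qed
    then show ?thesis
      unfolding tendsto_absval_iff [of _ "a + b"]
      by (intro tendsto_sandwich [OF _ _ tendsto_const tendsto_add_zero [OF 1 2]]) auto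
  qed
  show "(uminus \<longlongrightarrow> - a) (nhds a)" for a :: 'a
    using filterlim_ident [of "nhds a"] unfolding tendsto_absval_iff
    by (simp add: absval_minus_commute add.commute)
qed

instance nonarch_field \<subseteq> topological_semigroup_mult
proof
  show "((\<lambda>x. fst x * snd x) \<longlongrightarrow> a * b) (nhds a \<times>\<^sub>F nhds b)" for a b :: 'a
  proof -
    have 1: "((\<lambda>x. absval (fst x - a)) \<longlongrightarrow> 0) (nhds a \<times>\<^sub>F nhds b)"
      using filterlim_fst [of "nhds a" "nhds b"] by (simp flip: tendsto_absval_iff)
    have 2: "((\<lambda>x. absval (snd x - b)) \<longlongrightarrow> 0) (nhds a \<times>\<^sub>F nhds b)"
      using filterlim_snd [of "nhds b" "nhds a"] by (simp flip: tendsto_absval_iff)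
    have "((\<lambda>x. absval (fst x - a) * absval (snd x - b) + absval a * absval (snd x - b)
        + absval (fst x - a) * absval b) \<longlongrightarrow> 0 * 0 + absval a * 0 + 0 * absval b)
        (nhds a \<times>\<^sub>F nhds b)"
      by (intro tendsto_intros 1 2)
    then have lim: "((\<lambda>x. absval (fst x - a) * absval (snd x - b) + absval a * absval (snd x - b)
        + absval (fst x - a) * absval b) \<longlongrightarrow> 0) (nhds a \<times>\<^sub>F nhds b)"
      by simp
    have "absval (fst x * snd x - a * b) \<le> absval (fst x - a) * absval (snd x - b)
        + absval a * absval (snd x - b) + absval (fst x - a) * absval b" for x
    proof -
      have "fst x * snd x - a * b
          = (fst x - a) * (snd x - b) + (a * (snd x - b) + (fst x - a) * b)"
        by (simp add: algebra_simps)
      also have "absval \<dots> \<le> absval ((fst x - a) * (snd x - b))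
          + absval (a * (snd x - b)) + absval ((fst x - a) * b)"
        by (intro absval_add_le add_increasing add_increasing2) auto
      finally show ?thesis by (simp add: absval_mult)
    qed
    then show ?thesis
      unfolding tendsto_absval_iff [of _ "a * b"]
      by (intro tendsto_sandwich [OF _ _ tendsto_const lim]) auto
  qed
qed

instance nonarch_field \<subseteq> topological_monoid_mult ..

lemma eventually_absval_less:
  assumes "(F \<longlongrightarrow> (l::'a::nonarch_field)) G" "0 < e"
  shows "\<forall>\<^sub>F y in G. absval (F y - l) < e"
  using tendstoD [OF assms] by (simp add: dist_absval)

text \<open>
  The powers of an element of absolute value \<open>< 1\<close> accumulate at \<open>0\<close>; so nontriviality of the
  absolute value is what makes derivatives at a point unique.
\<close>

instance nonarch_field \<subseteq> perfect_space
proof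
  fix x :: 'a
  obtain a :: 'a where a: "a \<noteq> 0" "absval a < 1"
  proof -
    obtain b :: 'a where b: "b \<noteq> 0" "absval b \<noteq> 1" using absval_nontrivial by blast
    have "absval b * absval (inverse b) = 1"
      using b by (simp flip: absval_mult)
    then have "absval (inverse b) < 1" if "absval b > 1"
      using that mult_mono [of 1 "absval b" 1 "absval (inverse b)"] b
      by (smt (verit) mult_less_cancel_right1 absval_nonneg)
    then show thesis using that [of b] that [of "inverse b"] b by fastforce
  qed
  show "\<not> open {x}"
  proof
    assume "open {x}"
    then obtain e where e: "e > 0" "\<And>y. dist y x < e \<Longrightarrow> y = x"
      unfolding open_dist by auto
    have "\<forall>\<^sub>F n in sequentially. absval a ^ n < e"
      using LIMSEQ_realpow_zero [of "absval a"] a e(1) by (intro order_tendstoD) auto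
    then obtain n where "absval a ^ n < e" by (auto simp: eventually_sequentially)
    then show False using e(2) [of "x + a ^ n"] a by (simp add: dist_absval absval_power)
  qed
qed

section \<open>Convergent series\<close>

text \<open>
  By the strong triangle inequality a telescoping sum is no larger than its largest step.
  This is why a series converges as soon as its terms tend to zero.
\<close>

lemma Cauchy_of_consecutive:
  fixes X :: "nat \<Rightarrow> 'a::nonarch_field"
  assumes "(\<lambda>n. absval (X (Suc n) - X n)) \<longlonglongrightarrow> 0"
  shows "Cauchy X"
proof (rule metric_CauchyI)
  fix e :: real assume "e > 0"
  then have "\<forall>\<^sub>F n in sequentially. absval (X (Suc n) - X n) < e"
    using assms by (intro order_tendstoD)
  then obtain N where N: "\<And>n. n \<ge> N \<Longrightarrow> absval (X (Suc n) - X n) < e"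
    by (auto simp: eventually_sequentially)
  have *: "absval (X n - X N) < e" if "n \<ge> N" for n
    using that
  proof (induction rule: dec_induct)
    case (step n)
    then show ?case using absval_add [of "X (Suc n) - X n" "X n - X N"] N [of n] by simp
  qed (use \<open>e > 0\<close> in simp)
  have "dist (X m) (X n) < e" if "m \<ge> N" "n \<ge> N" for m n
    using absval_diff [of "X m - X N" "X n - X N"] * [OF that(1)] * [OF that(2)]
    by (simp add: dist_absval)
  then show "\<exists>M. \<forall>m\<ge>M. \<forall>n\<ge>M. dist (X m) (X n) < e" by blast
qed

lemma summable_iff_absval_tendsto:
  fixes a :: "nat \<Rightarrow> 'a::{nonarch_field,complete_space}"
  shows "summable a \<longleftrightarrow> (\<lambda>n. absval (a n)) \<longlonglongrightarrow> 0"
proof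
  assume "summable a"
  then obtain s where s: "(\<lambda>n. \<Sum>i<n. a i) \<longlonglongrightarrow> s" by (auto simp: summable_def sums_def)
  have "(\<lambda>n. (\<Sum>i<Suc n. a i) - (\<Sum>i<n. a i)) \<longlonglongrightarrow> s - s"
    by (intro tendsto_diff s LIMSEQ_Suc [OF s])
  then show "(\<lambda>n. absval (a n)) \<longlonglongrightarrow> 0"
    using tendsto_absval_iff [of a 0] by simp
next
  assume "(\<lambda>n. absval (a n)) \<longlonglongrightarrow> 0"
  then have "Cauchy (\<lambda>n. \<Sum>i<n. a i)" by (intro Cauchy_of_consecutive) simp
  then show "summable a" unfolding summable_iff_convergent by (rule Cauchy_convergent)
qed

lemma absval_le_of_tendsto:
  fixes X :: "nat \<Rightarrow> 'a::nonarch_field"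
  assumes "X \<longlonglongrightarrow> l" "\<forall>\<^sub>F n in sequentially. absval (X n) \<le> M"
  shows "absval l \<le> M"
proof -
  have "(\<lambda>n. dist (X n) 0) \<longlonglongrightarrow> dist l 0" by (intro tendsto_intros assms)
  then show ?thesis using assms(2) by (intro tendsto_upperbound) (auto simp: dist_absval)
qed

lemma absval_suminf_le:
  fixes a :: "nat \<Rightarrow> 'a::nonarch_field"
  assumes "summable a" "0 \<le> M" "\<And>n. absval (a n) \<le> M"
  shows "absval (suminf a) \<le> M"
  using summable_LIMSEQ [OF assms(1)]
  by (rule absval_le_of_tendsto) (use assms in \<open>auto intro!: always_eventually absval_sum_le\<close>)

section \<open>Power series on a closed disc\<close>

text \<open>
  Membership in the Tate algebra of the closed disc of radius \<open>r\<close>. Over a complete field, if \<open>r\<close> is the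
  absolute value of an element, this is convergence on that disc.
\<close>

definition tate :: "real \<Rightarrow> 'a::nonarch_field fps \<Rightarrow> bool" where
  "tate r c \<longleftrightarrow> (\<lambda>n. absval (fps_nth c n) * r ^ n) \<longlonglongrightarrow> 0"

text \<open>
  An upper bound for the Gauss norm, the supremum of the weighted coefficients.
\<close>

definition gauss_le :: "real \<Rightarrow> 'a::nonarch_field fps \<Rightarrow> real \<Rightarrow> bool" where
  "gauss_le r c M \<longleftrightarrow> (\<forall>n. absval (fps_nth c n) * r ^ n \<le> M)"

lemma gauss_leD: "gauss_le r c M \<Longrightarrow> absval (fps_nth c n) * r ^ n \<le> M"
  by (simp add: gauss_le_def)

lemma gauss_le_nonneg: "gauss_le r c M \<Longrightarrow> 0 \<le> M"
  using gauss_leD [of r c M 0] absval_nonneg [of "fps_nth c 0"] by (simp del: absval_nonneg)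

lemma tate_eventually:
  assumes "tate r c" "0 < e"
  shows "\<exists>N. \<forall>n\<ge>N. absval (fps_nth c n) * r ^ n < e"
  using order_tendstoD(2) [OF assms(1) [unfolded tate_def] assms(2)]
  by (simp add: eventually_sequentially)

lemma tateI:
  assumes "0 \<le> r" "\<And>e. 0 < e \<Longrightarrow> \<exists>N. \<forall>n\<ge>N. absval (fps_nth c n) * r ^ n \<le> e"
  shows "tate r c"
  unfolding tate_def
proof (rule LIMSEQ_I)
  fix e :: real assume "e > 0"
  then have "\<exists>N. \<forall>n\<ge>N. absval (fps_nth c n) * r ^ n \<le> e / 2"
    by (intro assms(2)) simp
  then obtain N where N: "\<And>n. n \<ge> N \<Longrightarrow> absval (fps_nth c n) * r ^ n \<le> e / 2" by blast
  have "norm (absval (fps_nth c n) * r ^ n - 0) < e" if "n \<ge> N" for n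
    using N [OF that] \<open>e > 0\<close> assms(1) by (simp add: abs_mult)
  then show "\<exists>N. \<forall>n\<ge>N. norm (absval (fps_nth c n) * r ^ n - 0) < e" by blast
qed

lemma tate_gauss_bounded:
  assumes "tate r c"
  obtains M where "0 < M" "gauss_le r c M"
proof -
  have "Bseq (\<lambda>n. absval (fps_nth c n) * r ^ n)"
    using assms unfolding tate_def by (intro convergent_imp_Bseq convergentI)
  then obtain K where K: "K > 0" "\<And>n. norm (absval (fps_nth c n) * r ^ n) \<le> K"
    by (blast dest: BseqD)
  have "absval (fps_nth c n) * r ^ n \<le> K" for n
    using abs_ge_self K(2) [of n] unfolding real_norm_def by (rule order_trans)
  then show thesis
    using that [OF K(1)] unfolding gauss_le_def by blast
qed

lemma tate_mono:
  assumes "tate r c" "0 \<le> s" "s \<le> r"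
  shows "tate s c"
proof (rule tateI)
  fix e :: real assume "e > 0"
  then obtain N where N: "\<And>n. n \<ge> N \<Longrightarrow> absval (fps_nth c n) * r ^ n < e"
    using tate_eventually [OF assms(1)] by blast
  have "absval (fps_nth c n) * s ^ n \<le> e" if "n \<ge> N" for n
    using N [OF that] mult_left_mono [OF power_mono [OF assms(3,2), of n], of "absval (fps_nth c n)"]
    by simp
  then show "\<exists>N. \<forall>n\<ge>N. absval (fps_nth c n) * s ^ n \<le> e" by blast
qed (fact assms)

lemma fps_converges_iff_tate:
  fixes c :: "'a::{nonarch_field,complete_space} fps"
  shows "fps_converges c x \<longleftrightarrow> tate (absval x) c"
  by (simp add: fps_converges_def summable_iff_absval_tendsto tate_def absval_mult absval_power)

lemma tate_fps_converges:
  fixes c :: "'a::{nonarch_field,complete_space} fps"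
  assumes "tate r c" "absval x \<le> r"
  shows "fps_converges c x"
  using tate_mono [OF assms(1) _ assms(2)] by (simp add: fps_converges_iff_tate)

lemma fps_at_sums:
  fixes c :: "'a::{nonarch_field,complete_space} fps"
  assumes "tate r c" "absval x \<le> r"
  shows "(\<lambda>n. fps_nth c n * x ^ n) sums fps_at c x"
  using tate_fps_converges [OF assms]
  unfolding fps_converges_def fps_at_def by (rule summable_sums)

lemma absval_term_le:
  assumes "absval x \<le> r"
  shows "absval (a * x ^ n) \<le> absval a * r ^ n"
  using power_mono [OF assms, of n] by (simp add: absval_mult absval_power mult_left_mono)

lemma absval_fps_at_le:
  fixes c :: "'a::{nonarch_field,complete_space} fps"
  assumes "tate r c" "absval x \<le> r" "gauss_le r c M"
  shows "absval (fps_at c x) \<le> M"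
  unfolding fps_at_def
proof (rule absval_suminf_le)
  show "summable (\<lambda>n. fps_nth c n * x ^ n)" using fps_at_sums [OF assms(1,2)] by (rule sums_summable)
  show "absval (fps_nth c n * x ^ n) \<le> M" for n
    using absval_term_le [OF assms(2)] gauss_leD [OF assms(3)] order_trans by blast
qed (use gauss_le_nonneg assms(3) in blast)

lemma gauss_le_add:
  assumes "0 \<le> r" "gauss_le r c M" "gauss_le r d M"
  shows "gauss_le r (c + d) M"
proof -
  have "absval (fps_nth (c + d) n) * r ^ n
      \<le> max (absval (fps_nth c n)) (absval (fps_nth d n)) * r ^ n" for n
    using absval_add [of "fps_nth c n" "fps_nth d n"] assms(1) by (intro mult_right_mono) auto
  then show ?thesis
    using gauss_leD [OF assms(2)] gauss_leD [OF assms(3)]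
    unfolding gauss_le_def by (smt (verit) max_def)
qed

lemma gauss_le_minus: "gauss_le r c M \<Longrightarrow> gauss_le r (- c) M"
  by (simp add: gauss_le_def)

lemma gauss_le_diff:
  "0 \<le> r \<Longrightarrow> gauss_le r c M \<Longrightarrow> gauss_le r d M \<Longrightarrow> gauss_le r (c - d) M"
  using gauss_le_add [of r c M "- d"] gauss_le_minus [of r d M] by simp

lemma gauss_le_zero: "0 \<le> M \<Longrightarrow> gauss_le r 0 M"
  by (simp add: gauss_le_def)

lemma gauss_le_sum:
  assumes "0 \<le> r" "0 \<le> M" "\<And>i. i \<in> A \<Longrightarrow> gauss_le r (F i) M"
  shows "gauss_le r (sum F A) M"
  using assms(3)
proof (induction A rule: infinite_finite_induct)
  case (insert a A)
  then show ?case using gauss_le_add [OF assms(1), of "F a" M "sum F A"] by simp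
qed (use assms(2) gauss_le_zero in auto)

lemma gauss_le_mult:
  assumes "0 \<le> r" "gauss_le r c A" "gauss_le r d B"
  shows "gauss_le r (c * d) (A * B)"
  unfolding gauss_le_def
proof
  fix n
  note nn = gauss_le_nonneg [OF assms(2)] gauss_le_nonneg [OF assms(3)]
  show "absval (fps_nth (c * d) n) * r ^ n \<le> A * B"
  proof (cases "r ^ n = 0")
    case False
    then have pos: "r ^ n > 0" using zero_le_power [OF assms(1), of n] by linarith
    have "absval (fps_nth (c * d) n) \<le> A * B / r ^ n"
      unfolding fps_mult_nth
    proof (rule absval_sum_le)
      fix i assume i: "i \<in> {0..n}"
      have "absval (fps_nth c i * fps_nth d (n - i)) * r ^ n =
          (absval (fps_nth c i) * r ^ i) * (absval (fps_nth d (n - i)) * r ^ (n - i))"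
        using power_add [of r i "n - i"] i by (simp add: absval_mult)
      also have "\<dots> \<le> A * B"
        using gauss_leD [OF assms(2)] gauss_leD [OF assms(3)] nn assms(1)
        by (intro mult_mono) auto
      finally show "absval (fps_nth c i * fps_nth d (n - i)) \<le> A * B / r ^ n"
        using pos by (simp add: field_simps)
    qed (use nn pos in simp)
    then show ?thesis using pos by (simp add: field_simps)
  qed (use nn in \<open>simp only: mult_zero_right mult_nonneg_nonneg\<close>)
qed

lemma gauss_le_one: "gauss_le r 1 1"
  by (simp add: gauss_le_def)

lemma gauss_le_power:
  assumes "0 \<le> r" "gauss_le r c A"
  shows "gauss_le r (c ^ k) (A ^ k)"
  by (induction k) (use assms in \<open>auto intro: gauss_le_mult gauss_le_one\<close>)

text \<open>
  If the sum of two indices is large, one of them is large and its factor is small, while the other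
  factor is bounded. This is the common core of the closure of the Tate algebra under products and of the fact that
  evaluation is multiplicative.
\<close>

lemma convolution_small:
  fixes u v :: "nat \<Rightarrow> real"
  assumes "u \<longlonglongrightarrow> 0" "v \<longlonglongrightarrow> 0" "0 < e"
  obtains N where "\<And>n i. n \<ge> N \<Longrightarrow> i \<le> n \<Longrightarrow> \<bar>u i * v (n - i)\<bar> \<le> e"
proof -
  have "Bseq u" "Bseq v" using assms by (auto intro: convergent_imp_Bseq convergentI)
  then obtain A B where A: "A > 0" "\<And>n. \<bar>u n\<bar> \<le> A" and B: "B > 0" "\<And>n. \<bar>v n\<bar> \<le> B"
    unfolding Bseq_def real_norm_def by blast
  have "\<exists>N. \<forall>n\<ge>N. \<bar>u n\<bar> < e / B" "\<exists>N. \<forall>n\<ge>N. \<bar>v n\<bar> < e / A"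
    using LIMSEQ_D [OF assms(1), of "e / B"] LIMSEQ_D [OF assms(2), of "e / A"] assms(3) A(1) B(1)
    by auto
  then obtain N1 N2 where N1: "\<And>n. n \<ge> N1 \<Longrightarrow> \<bar>u n\<bar> < e / B"
    and N2: "\<And>n. n \<ge> N2 \<Longrightarrow> \<bar>v n\<bar> < e / A" by blast
  have "\<bar>u i * v (n - i)\<bar> \<le> e" if n: "n \<ge> N1 + N2" and i: "i \<le> n" for n i
  proof (cases "i \<ge> N1")
    case True
    have "\<bar>u i\<bar> * \<bar>v (n - i)\<bar> \<le> e / B * B"
      using N1 [OF True] B assms(3) by (intro mult_mono) auto
    then show ?thesis using B(1) by (simp add: abs_mult)
  next
    case False
    have "\<bar>u i\<bar> * \<bar>v (n - i)\<bar> \<le> A * (e / A)"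
      using N2 [of "n - i"] A False n by (intro mult_mono) (auto simp: less_imp_le)
    then show ?thesis using A(1) by (simp add: abs_mult)
  qed
  then show thesis using that by blast
qed

lemma tate_mult:
  assumes r: "0 \<le> r" and c: "tate r c" and d: "tate r d"
  shows "tate r (c * d)"
proof (rule tateI)
  fix e :: real assume e: "e > 0"
  obtain N where N: "\<And>n i. n \<ge> N \<Longrightarrow> i \<le> n \<Longrightarrow>
      \<bar>(absval (fps_nth c i) * r ^ i) * (absval (fps_nth d (n - i)) * r ^ (n - i))\<bar> \<le> e"
    using convolution_small [OF c [unfolded tate_def] d [unfolded tate_def] e] by blast
  have "absval (fps_nth (c * d) n) * r ^ n \<le> e" if n: "n \<ge> N" for n
  proof (cases "r ^ n = 0")
    case False
    then have pos: "r ^ n > 0" using zero_le_power [OF r, of n] by linarith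
    have "absval (fps_nth (c * d) n) \<le> e / r ^ n"
      unfolding fps_mult_nth
    proof (rule absval_sum_le)
      fix i assume i: "i \<in> {0..n}"
      have "absval (fps_nth c i * fps_nth d (n - i)) * r ^ n =
          (absval (fps_nth c i) * r ^ i) * (absval (fps_nth d (n - i)) * r ^ (n - i))"
        using power_add [of r i "n - i"] i by (simp add: absval_mult)
      also have "\<dots> \<le> e"
        using N [OF n, of i] i by simp
      finally show "absval (fps_nth c i * fps_nth d (n - i)) \<le> e / r ^ n"
        using pos by (simp add: field_simps)
    qed (use e pos in simp)
    then show ?thesis using pos by (simp add: field_simps)
  qed (use e in \<open>simp only: mult_zero_right order_less_imp_le\<close>)
  then show "\<exists>N. \<forall>n\<ge>N. absval (fps_nth (c * d) n) * r ^ n \<le> e" by blast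
qed (fact r)

text \<open>
  The Tate algebra is closed in the Gauss norm: this is how convergence of a composition, and
  later of an inverse series, is derived from convergence of approximations.
\<close>

lemma tate_approx:
  assumes r: "0 \<le> r"
    and ex: "\<And>e. 0 < e \<Longrightarrow> \<exists>p. tate r p \<and> gauss_le r (c - p) e"
  shows "tate r c"
proof (rule tateI)
  fix e :: real assume e: "e > 0"
  obtain p where p: "tate r p" "gauss_le r (c - p) e" using ex [OF e] by blast
  obtain N where N: "\<And>n. n \<ge> N \<Longrightarrow> absval (fps_nth p n) * r ^ n < e"
    using tate_eventually [OF p(1) e] by blast
  have "absval (fps_nth c n) * r ^ n \<le> e" if n: "n \<ge> N" for n
  proof -
    have "absval (fps_nth c n) \<le> max (absval (fps_nth (c - p) n)) (absval (fps_nth p n))"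
      using absval_add [of "fps_nth (c - p) n" "fps_nth p n"] by simp
    then have "absval (fps_nth c n) * r ^ n
        \<le> max (absval (fps_nth (c - p) n)) (absval (fps_nth p n)) * r ^ n"
      using r by (intro mult_right_mono) auto
    then show ?thesis using gauss_leD [OF p(2), of n] N [OF n] by (smt (verit) max_def)
  qed
  then show "\<exists>N. \<forall>n\<ge>N. absval (fps_nth c n) * r ^ n \<le> e" by blast
qed (fact r)

lemma tate_eventually_zero:
  assumes "0 \<le> r" "\<And>n. n \<ge> N \<Longrightarrow> fps_nth c n = 0"
  shows "tate r c"
  by (rule tateI) (use assms in \<open>auto intro!: exI [of _ N]\<close>)

lemma tate_const: "0 \<le> r \<Longrightarrow> tate r (fps_const a)"
  by (rule tate_eventually_zero [where N = 1]) auto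

lemma tate_X: "0 \<le> r \<Longrightarrow> tate r fps_X"
  by (rule tate_eventually_zero [where N = 2]) auto

lemma tate_add:
  assumes "0 \<le> r" "tate r c" "tate r d"
  shows "tate r (c + d)"
proof (rule tateI)
  fix e :: real assume e: "e > 0"
  obtain N1 N2 where N: "\<And>n. n \<ge> N1 \<Longrightarrow> absval (fps_nth c n) * r ^ n < e"
    "\<And>n. n \<ge> N2 \<Longrightarrow> absval (fps_nth d n) * r ^ n < e"
    using tate_eventually [OF assms(2) e] tate_eventually [OF assms(3) e] by blast
  have "absval (fps_nth (c + d) n) * r ^ n \<le> e" if n: "n \<ge> max N1 N2" for n
  proof -
    have "absval (fps_nth (c + d) n) * r ^ n
        \<le> max (absval (fps_nth c n)) (absval (fps_nth d n)) * r ^ n"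
      using assms(1) absval_add by (intro mult_right_mono) auto
    then show ?thesis using N(1) [of n] N(2) [of n] n by (auto simp: max_def split: if_splits)
  qed
  then show "\<exists>N. \<forall>n\<ge>N. absval (fps_nth (c + d) n) * r ^ n \<le> e" by blast
qed (fact assms)

lemma tate_minus: "tate r c \<Longrightarrow> tate r (- c)"
  by (simp add: tate_def)

lemma tate_diff: "0 \<le> r \<Longrightarrow> tate r c \<Longrightarrow> tate r d \<Longrightarrow> tate r (c - d)"
  using tate_add [of r c "- d"] tate_minus [of r d] by simp

lemma tate_sum:
  assumes "0 \<le> r" "\<And>i. i \<in> A \<Longrightarrow> tate r (F i)"
  shows "tate r (sum F A)"
  using assms(2)
proof (induction A rule: infinite_finite_induct)
  case (insert a A)
  then show ?case using tate_add [OF assms(1), of "F a" "sum F A"] by simp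
qed (use tate_const [of r 0] assms(1) in auto)

lemma tate_power: "0 \<le> r \<Longrightarrow> tate r c \<Longrightarrow> tate r (c ^ k)"
  by (induction k) (use tate_const [of r 1] in \<open>auto intro: tate_mult\<close>)

lemma fps_at_0: "fps_at c 0 = fps_nth c 0"
proof -
  have "(\<lambda>n. fps_nth c n * 0 ^ n) sums (fps_nth c 0 * 0 ^ 0)"
    by (rule sums_finite [of "{0}", simplified]) auto
  then show ?thesis by (simp add: fps_at_def sums_iff)
qed

lemma fps_at_const: "fps_at (fps_const a) x = a"
proof -
  have "(\<lambda>n. fps_nth (fps_const a) n * x ^ n) sums (\<Sum>n\<in>{0}. fps_nth (fps_const a) n * x ^ n)"
    by (rule sums_finite) auto
  then show ?thesis by (simp add: fps_at_def sums_iff)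
qed

lemma fps_at_X: "fps_at fps_X x = x"
proof -
  have "(\<lambda>n. fps_nth fps_X n * x ^ n) sums (\<Sum>n\<in>{1}. fps_nth fps_X n * x ^ n)"
    by (rule sums_finite) auto
  then show ?thesis by (simp add: fps_at_def sums_iff)
qed

lemma fps_at_add:
  fixes c :: "'a::{nonarch_field,complete_space} fps"
  assumes "tate r c" "tate r d" "absval x \<le> r"
  shows "fps_at (c + d) x = fps_at c x + fps_at d x"
  using sums_add [OF fps_at_sums [OF assms(1,3)] fps_at_sums [OF assms(2,3)]]
  by (simp add: fps_at_def [of "c + d"] sums_iff algebra_simps)

lemma fps_at_minus:
  fixes c :: "'a::{nonarch_field,complete_space} fps"
  assumes "tate r c" "absval x \<le> r"
  shows "fps_at (- c) x = - fps_at c x"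
proof -
  have "fps_at (- c) x + fps_at c x = fps_at (- c + c) x"
    using fps_at_add [OF tate_minus [OF assms(1)] assms] by simp
  also have "\<dots> = 0" using fps_at_const [of 0 x] by simp
  finally show ?thesis by (simp add: eq_neg_iff_add_eq_0)
qed

lemma fps_at_diff:
  fixes c :: "'a::{nonarch_field,complete_space} fps"
  assumes "tate r c" "tate r d" "absval x \<le> r"
  shows "fps_at (c - d) x = fps_at c x - fps_at d x"
  using fps_at_add [OF assms(1) tate_minus [OF assms(2)] assms(3)] fps_at_minus [OF assms(2,3)]
  by simp

lemma sum_convolution_eq:
  fixes a b :: "nat \<Rightarrow> 'a::comm_ring"
  shows "(\<Sum>n<N. \<Sum>i=0..n. a i * b (n - i)) = (\<Sum>i<N. a i * (\<Sum>j<N - i. b j))"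
proof -
  have "(\<Sum>n<N. \<Sum>i=0..n. a i * b (n - i)) = (\<Sum>(i, j)\<in>{(i, j). i + j < N}. a i * b j)"
    using sum.triangle_reindex [of "\<lambda>i j. a i * b j" N] by (simp add: atLeast0AtMost)
  also have "{(i, j). i + j < N} = (SIGMA i:{..<N}. {..<N - i})" by auto
  also have "(\<Sum>(i, j)\<in>\<dots>. a i * b j) = (\<Sum>i<N. \<Sum>j<N - i. a i * b j)"
    by (rule sum.Sigma [symmetric]) auto
  finally show ?thesis by (simp add: sum_distrib_left)
qed

text \<open>
  A partial sum of the Cauchy product differs from the corresponding partial sum of \<open>c\<close> times the
  full value of \<open>d\<close> by a convolution of the terms of \<open>c\<close> with the tails of \<open>d\<close>.
\<close>

lemma fps_at_mult:
  fixes c :: "'a::{nonarch_field,complete_space} fps"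
  assumes r: "0 \<le> r" and c: "tate r c" and d: "tate r d" and x: "absval x \<le> r"
  shows "fps_at (c * d) x = fps_at c x * fps_at d x"
proof -
  define a where "a = (\<lambda>n. fps_nth c n * x ^ n)"
  define b where "b = (\<lambda>n. fps_nth d n * x ^ n)"
  have a: "a sums fps_at c x" and b: "b sums fps_at d x"
    using fps_at_sums [OF c x] fps_at_sums [OF d x] by (simp_all add: a_def b_def)
  have cd: "(\<lambda>N. \<Sum>n<N. fps_nth (c * d) n * x ^ n) \<longlonglongrightarrow> fps_at (c * d) x"
    using fps_at_sums [OF tate_mult [OF r c d] x] by (simp add: sums_def)
  have eq: "fps_nth (c * d) n * x ^ n = (\<Sum>i=0..n. a i * b (n - i))" for n
    unfolding fps_mult_nth sum_distrib_right
    by (rule sum.cong) (auto simp: a_def b_def simp flip: power_add)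
  have "(\<lambda>N. (\<Sum>i<N. a i) * fps_at d x - (\<Sum>n<N. fps_nth (c * d) n * x ^ n)) \<longlonglongrightarrow>
      fps_at c x * fps_at d x - fps_at (c * d) x"
    using a unfolding sums_def by (intro tendsto_intros cd)
  then have lim: "(\<lambda>N. \<Sum>i<N. a i * (fps_at d x - (\<Sum>j<N - i. b j))) \<longlonglongrightarrow>
      fps_at c x * fps_at d x - fps_at (c * d) x"
    unfolding eq sum_convolution_eq
    by (simp add: sum_distrib_right sum_subtractf [symmetric] right_diff_distrib)
  have u: "(\<lambda>i. absval (a i)) \<longlonglongrightarrow> 0"
    using a by (simp add: sums_summable flip: summable_iff_absval_tendsto)
  have v: "(\<lambda>j. absval (fps_at d x - (\<Sum>k<j. b k))) \<longlonglongrightarrow> 0"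
    using b unfolding sums_def tendsto_absval_iff [of _ "fps_at d x"]
    by (simp add: absval_minus_commute)
  have "absval (fps_at c x * fps_at d x - fps_at (c * d) x) \<le> e" if e: "e > 0" for e
  proof (rule absval_le_of_tendsto [OF lim])
    obtain M where "\<And>n i. n \<ge> M \<Longrightarrow> i \<le> n \<Longrightarrow>
        \<bar>absval (a i) * absval (fps_at d x - (\<Sum>k<n - i. b k))\<bar> \<le> e"
      using convolution_small [OF u v e] by blast
    then have "absval (\<Sum>i<n. a i * (fps_at d x - (\<Sum>j<n - i. b j))) \<le> e" if "n \<ge> M" for n
      using that e by (intro absval_sum_le) (auto simp: absval_mult)
    then show "\<forall>\<^sub>F n in sequentially. absval (\<Sum>i<n. a i * (fps_at d x - (\<Sum>j<n - i. b j))) \<le> e"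
      by (auto simp: eventually_sequentially)
  qed
  then have "absval (fps_at c x * fps_at d x - fps_at (c * d) x) \<le> 0"
    by (rule field_le_epsilon [where y = 0, simplified])
  then show ?thesis using absval_eq_0_iff absval_nonneg by (metis antisym eq_iff_diff_eq_0)
qed

lemma fps_at_power:
  fixes c :: "'a::{nonarch_field,complete_space} fps"
  assumes "0 \<le> r" "tate r c" "absval x \<le> r"
  shows "fps_at (c ^ k) x = fps_at c x ^ k"
proof (induction k)
  case 0
  then show ?case using fps_at_const [of 1 x] by simp
next
  case (Suc k)
  then show ?case using fps_at_mult [OF assms(1,2) tate_power [OF assms(1,2)] assms(3)] by simp
qed

lemma fps_at_sum:
  fixes F :: "'b \<Rightarrow> 'a::{nonarch_field,complete_space} fps"
  assumes "0 \<le> r" "\<And>i. i \<in> A \<Longrightarrow> tate r (F i)" "absval x \<le> r"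
  shows "fps_at (sum F A) x = (\<Sum>i\<in>A. fps_at (F i) x)"
  using assms(2)
proof (induction A rule: infinite_finite_induct)
  case (insert a A)
  then show ?case using assms(1,3) by (simp add: fps_at_add [of r] tate_sum)
qed (use fps_at_const [of 0 x] in auto)

section \<open>Composition of series\<close>

text \<open>
  As the inner series has Gauss norm at most \<open>r\<close>, substituting it does not increase Gauss
  norms: cutting off a tail of the outer series changes the composition no more than the size
  of that tail.
\<close>

lemma fps_compose_approx:
  fixes c \<phi> :: "'a::{nonarch_field,complete_space} fps"
  assumes r: "0 < r" and c: "tate r c" and \<phi>: "tate r \<phi>" "fps_nth \<phi> 0 = 0" "gauss_le r \<phi> r"
    and e: "0 < e"
  shows "\<exists>N. \<forall>M\<ge>N. gauss_le r ((c oo \<phi>) - (\<Sum>i<M. fps_const (fps_nth c i) * \<phi> ^ i)) e"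
proof -
  obtain N where N: "\<And>n. n \<ge> N \<Longrightarrow> absval (fps_nth c n) * r ^ n < e"
    using tate_eventually [OF c e] by blast
  have "gauss_le r ((c oo \<phi>) - (\<Sum>i<M. fps_const (fps_nth c i) * \<phi> ^ i)) e" if M: "M \<ge> N" for M
    unfolding gauss_le_def
  proof
    fix n
    have "fps_nth (c oo \<phi>) n = (\<Sum>i<max M (Suc n). fps_nth c i * fps_nth (\<phi> ^ i) n)"
      unfolding fps_compose_nth
      by (rule sum.mono_neutral_left) (use startsby_zero_power_prefix [OF \<phi>(2)] in auto)
    also have "{..<max M (Suc n)} = {..<M} \<union> {M..<max M (Suc n)}" by auto
    also have "(\<Sum>i\<in>\<dots>. fps_nth c i * fps_nth (\<phi> ^ i) n) =
        (\<Sum>i<M. fps_nth c i * fps_nth (\<phi> ^ i) n) +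
        (\<Sum>i\<in>{M..<max M (Suc n)}. fps_nth c i * fps_nth (\<phi> ^ i) n)"
      by (rule sum.union_disjoint) auto
    finally have eq: "fps_nth ((c oo \<phi>) - (\<Sum>i<M. fps_const (fps_nth c i) * \<phi> ^ i)) n =
        (\<Sum>i\<in>{M..<max M (Suc n)}. fps_nth c i * fps_nth (\<phi> ^ i) n)"
      by (simp add: fps_sum_nth)
    have "absval (fps_nth c i * fps_nth (\<phi> ^ i) n) \<le> e / r ^ n" if i: "i \<in> {M..<max M (Suc n)}" for i
    proof -
      have "absval (fps_nth (\<phi> ^ i) n) * r ^ n \<le> r ^ i"
        using r \<phi> by (intro gauss_leD gauss_le_power) auto
      then have "absval (fps_nth c i) * (absval (fps_nth (\<phi> ^ i) n) * r ^ n) \<le> e"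
        using N [of i] i M by (smt (verit) mult_left_mono absval_nonneg atLeastLessThan_iff order.trans)
      then show ?thesis using r by (simp add: field_simps absval_mult)
    qed
    then have "absval (fps_nth ((c oo \<phi>) - (\<Sum>i<M. fps_const (fps_nth c i) * \<phi> ^ i)) n) \<le> e / r ^ n"
      unfolding eq using e r by (intro absval_sum_le) auto
    then show "absval (fps_nth ((c oo \<phi>) - (\<Sum>i<M. fps_const (fps_nth c i) * \<phi> ^ i)) n) * r ^ n \<le> e"
      using r by (simp add: field_simps)
  qed
  then show ?thesis by blast
qed

lemma tate_compose:
  fixes c \<phi> :: "'a::{nonarch_field,complete_space} fps"
  assumes r: "0 < r" and c: "tate r c" and \<phi>: "tate r \<phi>" "fps_nth \<phi> 0 = 0" "gauss_le r \<phi> r"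
  shows "tate r (c oo \<phi>)"
proof (rule tate_approx)
  fix e :: real assume "e > 0"
  then obtain N where "gauss_le r ((c oo \<phi>) - (\<Sum>i<N. fps_const (fps_nth c i) * \<phi> ^ i)) e"
    using fps_compose_approx [OF assms] by blast
  moreover have "tate r (\<Sum>i<N. fps_const (fps_nth c i) * \<phi> ^ i)"
    using r \<phi>(1) by (intro tate_sum tate_mult tate_const tate_power) auto
  ultimately show "\<exists>p. tate r p \<and> gauss_le r ((c oo \<phi>) - p) e" by blast
qed (use r in simp)

lemma fps_at_compose:
  fixes c \<phi> :: "'a::{nonarch_field,complete_space} fps"
  assumes r: "0 < r" and c: "tate r c" and \<phi>: "tate r \<phi>" "fps_nth \<phi> 0 = 0" "gauss_le r \<phi> r"
    and x: "absval x \<le> r"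
  shows "fps_at (c oo \<phi>) x = fps_at c (fps_at \<phi> x)"
proof -
  define S where "S = (\<lambda>N. \<Sum>i<N. fps_const (fps_nth c i) * \<phi> ^ i)"
  have S: "tate r (S N)" for N
    unfolding S_def using r \<phi>(1) by (intro tate_sum tate_mult tate_const tate_power) auto
  have S_at: "fps_at (S N) x = (\<Sum>i<N. fps_nth c i * fps_at \<phi> x ^ i)" for N
    unfolding S_def using r \<phi>(1) x
    by (simp add: fps_at_sum [of r] fps_at_mult [of r] fps_at_const fps_at_power [of r]
        tate_mult tate_const tate_power)
  have "absval (fps_at \<phi> x) \<le> r" using absval_fps_at_le [OF \<phi>(1) x \<phi>(3)] .
  from fps_at_sums [OF c this] have 1: "(\<lambda>N. fps_at (S N) x) \<longlonglongrightarrow> fps_at c (fps_at \<phi> x)"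
    by (simp add: sums_def S_at)
  have "(\<lambda>N. fps_at (S N) x) \<longlonglongrightarrow> fps_at (c oo \<phi>) x"
    unfolding tendsto_absval_iff [of _ "fps_at (c oo \<phi>) x"]
  proof (rule LIMSEQ_I)
    fix e :: real assume "e > 0"
    then obtain N where N: "\<And>M. M \<ge> N \<Longrightarrow> gauss_le r ((c oo \<phi>) - S M) (e / 2)"
      using fps_compose_approx [OF r c \<phi>, of "e / 2"] unfolding S_def by auto
    have "absval (fps_at (S M) x - fps_at (c oo \<phi>) x) \<le> e / 2" if "M \<ge> N" for M
      using absval_fps_at_le [OF tate_diff [OF _ tate_compose [OF r c \<phi>] S] x N [OF that]] r
      by (simp add: fps_at_diff [OF tate_compose [OF r c \<phi>] S x] absval_minus_commute)
    then have "norm (absval (fps_at (S n) x - fps_at (c oo \<phi>) x) - 0) < e" if "n \<ge> N" for n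
      using that \<open>e > 0\<close> by fastforce
    then show "\<exists>N. \<forall>n\<ge>N. norm (absval (fps_at (S n) x - fps_at (c oo \<phi>) x) - 0) < e" by blast
  qed
  from LIMSEQ_unique [OF this 1] show ?thesis .
qed

section \<open>Division by a linear factor\<close>

lemma tate_shift:
  assumes "0 < r" "tate r c"
  shows "tate r (fps_shift m c)"
proof -
  have "(\<lambda>n. absval (fps_nth c (n + m)) * r ^ (n + m) / r ^ m) \<longlonglongrightarrow> 0 / r ^ m"
    using LIMSEQ_ignore_initial_segment [OF assms(2) [unfolded tate_def], of m] assms(1)
    by (intro tendsto_divide tendsto_const) auto
  then show ?thesis
    using assms(1) by (simp add: tate_def power_add)
qed

lemma fps_at_shift:
  fixes c :: "'a::{nonarch_field,complete_space} fps"
  assumes "0 < r" "tate r c" "absval x \<le> r"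
  shows "fps_at c x = fps_nth c 0 + x * fps_at (fps_shift 1 c) x"
proof -
  have "c = fps_const (fps_nth c 0) + fps_X * fps_shift 1 c"
    by (simp add: fps_eq_iff)
  moreover have "fps_at (fps_const (fps_nth c 0) + fps_X * fps_shift 1 c) x =
      fps_nth c 0 + x * fps_at (fps_shift 1 c) x"
    using assms tate_shift [OF assms(1,2), of 1]
    by (simp add: fps_at_add [of r] fps_at_mult [of r] fps_at_const fps_at_X tate_const tate_X tate_mult)
  ultimately show ?thesis by simp
qed

text \<open>
  The quotient of \<open>c - c x\<close> by \<open>X - x\<close>: its \<open>n\<close>-th coefficient is the sum of
  \<open>c\<^sub>k x\<^bsup>k-n-1\<^esup>\<close> over \<open>k > n\<close>, as in synthetic division.
\<close>

definition fps_quotient :: "'a::nonarch_field fps \<Rightarrow> 'a \<Rightarrow> 'a fps" where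
  "fps_quotient c x = Abs_fps (\<lambda>n. fps_at (fps_shift (Suc n) c) x)"

lemma fps_quotient_nth:
  fixes c :: "'a::{nonarch_field,complete_space} fps"
  assumes "0 < r" "tate r c" "absval x \<le> r"
  shows "fps_nth (fps_quotient c x) n = fps_nth c (Suc n) + x * fps_nth (fps_quotient c x) (Suc n)"
proof -
  have "fps_shift 1 (fps_shift (Suc n) c) = fps_shift (Suc (Suc n)) c" by (simp add: fps_eq_iff)
  then show ?thesis
    using fps_at_shift [OF assms(1) tate_shift [OF assms(1,2)] assms(3), of "Suc n"]
    by (simp add: fps_quotient_def)
qed

lemma fps_quotient_eq:
  fixes c :: "'a::{nonarch_field,complete_space} fps"
  assumes "0 < r" "tate r c" "absval x \<le> r"
  shows "c = fps_const (fps_at c x) + (fps_X - fps_const x) * fps_quotient c x"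
proof (rule fps_ext)
  fix n
  show "fps_nth c n = fps_nth (fps_const (fps_at c x) + (fps_X - fps_const x) * fps_quotient c x) n"
  proof (cases n)
    case 0
    then show ?thesis using fps_at_shift [OF assms] by (simp add: fps_quotient_def)
  next
    case (Suc m)
    then show ?thesis using fps_quotient_nth [OF assms, of m] by (simp add: left_diff_distrib)
  qed
qed

lemma absval_fps_quotient_le:
  fixes c :: "'a::{nonarch_field,complete_space} fps"
  assumes r: "0 < r" and c: "tate r c" and x: "absval x \<le> r"
    and M: "0 \<le> M" "\<And>k. k > n \<Longrightarrow> absval (fps_nth c k) * r ^ k \<le> M"
  shows "absval (fps_nth (fps_quotient c x) n) * r ^ Suc n \<le> M"
proof -
  have "gauss_le r (fps_shift (Suc n) c) (M / r ^ Suc n)"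
    unfolding gauss_le_def
  proof
    fix k
    show "absval (fps_nth (fps_shift (Suc n) c) k) * r ^ k \<le> M / r ^ Suc n"
      using M(2) [of "k + Suc n"] r by (simp add: field_simps power_add)
  qed
  then have "absval (fps_nth (fps_quotient c x) n) \<le> M / r ^ Suc n"
    using absval_fps_at_le [OF tate_shift [OF r c] x] by (simp add: fps_quotient_def)
  then show ?thesis using r by (simp add: field_simps)
qed

lemma tate_quotient:
  fixes c :: "'a::{nonarch_field,complete_space} fps"
  assumes r: "0 < r" and c: "tate r c" and x: "absval x \<le> r"
  shows "tate r (fps_quotient c x)"
proof (rule tateI)
  fix e :: real assume e: "e > 0"
  then obtain N where N: "\<And>k. k \<ge> N \<Longrightarrow> absval (fps_nth c k) * r ^ k < e * r"
    using tate_eventually [OF c, of "e * r"] r by auto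
  have "absval (fps_nth (fps_quotient c x) n) * r ^ n \<le> e" if n: "n \<ge> N" for n
  proof -
    have "absval (fps_nth (fps_quotient c x) n) * r ^ Suc n \<le> e * r"
    proof (rule absval_fps_quotient_le [OF r c x])
      fix k assume "k > n"
      then show "absval (fps_nth c k) * r ^ k \<le> e * r" using N [of k] n by simp
    qed (use e r in simp)
    then show ?thesis using r by (simp add: mult.assoc [symmetric] mult.commute [of r])
  qed
  then show "\<exists>N. \<forall>n\<ge>N. absval (fps_nth (fps_quotient c x) n) * r ^ n \<le> e" by blast
qed (use r in simp)

lemma fps_at_quotient:
  fixes c :: "'a::{nonarch_field,complete_space} fps"
  assumes r: "0 < r" and c: "tate r c" and x: "absval x \<le> r" and y: "absval y \<le> r"
  shows "fps_at c y - fps_at c x = (y - x) * fps_at (fps_quotient c x) y"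
proof -
  have t: "tate r (fps_const (fps_at c x))" "tate r (fps_X - fps_const x)"
    using r by (auto intro!: tate_const tate_diff tate_X)
  have "fps_at c y = fps_at (fps_const (fps_at c x) + (fps_X - fps_const x) * fps_quotient c x) y"
    using fps_quotient_eq [OF r c x] by simp
  also have "\<dots> = fps_at c x + (y - x) * fps_at (fps_quotient c x) y"
    using r t tate_quotient [OF r c x] y
    by (simp add: fps_at_add [of r] fps_at_mult [of r] tate_mult fps_at_const fps_at_X
        fps_at_diff [of r] tate_X tate_const)
  finally show ?thesis by simp
qed

lemma fps_at_Lipschitz:
  fixes c :: "'a::{nonarch_field,complete_space} fps"
  assumes r: "0 < r" and c: "tate r c"
  obtains L where "0 < L"
    "\<And>x y. absval x \<le> r \<Longrightarrow> absval y \<le> r \<Longrightarrow> absval (fps_at c y - fps_at c x) \<le> L * absval (y - x)"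
proof -
  obtain M where M: "0 < M" "gauss_le r c M" using tate_gauss_bounded [OF c] by blast
  have "absval (fps_at c y - fps_at c x) \<le> M / r * absval (y - x)"
    if x: "absval x \<le> r" and y: "absval y \<le> r" for x y
  proof -
    have "gauss_le r (fps_quotient c x) (M / r)"
      unfolding gauss_le_def
    proof
      fix n
      have "absval (fps_nth (fps_quotient c x) n) * r ^ Suc n \<le> M"
        using M by (intro absval_fps_quotient_le [OF r c x] gauss_leD) auto
      then show "absval (fps_nth (fps_quotient c x) n) * r ^ n \<le> M / r"
        using r by (simp add: field_simps)
    qed
    then have "absval (fps_at (fps_quotient c x) y) \<le> M / r"
      by (rule absval_fps_at_le [OF tate_quotient [OF r c x] y])
    then have "absval (y - x) * absval (fps_at (fps_quotient c x) y) \<le> absval (y - x) * (M / r)"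
      by (intro mult_left_mono) auto
    then show ?thesis
      unfolding fps_at_quotient [OF r c x y] absval_mult by (simp add: mult.commute)
  qed
  then show thesis using that [of "M / r"] M(1) r by simp
qed

lemma eventually_absval_le_nhds:
  assumes "absval (x::'a::nonarch_field) \<le> r" "0 < r"
  shows "\<forall>\<^sub>F y in nhds x. absval y \<le> r"
proof -
  have "\<forall>\<^sub>F y in nhds x. absval (y - x) < r"
    by (intro eventually_absval_less filterlim_ident assms)
  then show ?thesis
  proof eventually_elim
    case (elim y)
    then show ?case using absval_add_le [of "y - x" r x] assms by simp
  qed
qed

lemma tendsto_fps_at:
  fixes c :: "'a::{nonarch_field,complete_space} fps"
  assumes r: "0 < r" and c: "tate r c" and x: "absval x \<le> r"
  shows "(fps_at c \<longlongrightarrow> fps_at c x) (nhds x)"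
proof -
  obtain L where L: "0 < L" "\<And>x y. absval x \<le> r \<Longrightarrow> absval y \<le> r \<Longrightarrow>
      absval (fps_at c y - fps_at c x) \<le> L * absval (y - x)"
    using fps_at_Lipschitz [OF r c] by blast
  have "((\<lambda>y. absval (y - x)) \<longlongrightarrow> 0) (nhds x)"
    using filterlim_ident [of "nhds x"] by (simp flip: tendsto_absval_iff)
  then have lim: "((\<lambda>y. L * absval (y - x)) \<longlongrightarrow> 0) (nhds x)"
    using tendsto_mult_left [of _ 0 _ L] by fastforce
  show ?thesis
    unfolding tendsto_absval_iff [of _ "fps_at c x"]
  proof (rule tendsto_sandwich [OF _ _ tendsto_const lim])
    show "\<forall>\<^sub>F y in nhds x. absval (fps_at c y - fps_at c x) \<le> L * absval (y - x)"
      using eventually_absval_le_nhds [OF x r] by eventually_elim (use L(2) x in blast)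
  qed auto
qed

section \<open>The Weierstrass degree\<close>

text \<open>
  The last index at which the weighted coefficients attain their maximum. For the zero series
  there is none, whence a relation. As long as it is
  positive, it drops by one with each division by \<open>X - x\<close> for a point \<open>x\<close> of the disc, so that
  repeated division terminates.
\<close>

definition weierstrass_degree :: "real \<Rightarrow> 'a::nonarch_field fps \<Rightarrow> nat \<Rightarrow> bool" where
  "weierstrass_degree r c d \<longleftrightarrow> fps_nth c d \<noteq> 0 \<and>
     (\<forall>n. absval (fps_nth c n) * r ^ n \<le> absval (fps_nth c d) * r ^ d) \<and>
     (\<forall>n>d. absval (fps_nth c n) * r ^ n < absval (fps_nth c d) * r ^ d)"

lemma ex_weierstrass_degree:
  assumes r: "0 < r" and c: "tate r c" "c \<noteq> 0"
  shows "\<exists>d. weierstrass_degree r c d"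
proof -
  define v where "v = (\<lambda>n. absval (fps_nth c n) * r ^ n)"
  obtain m where m: "fps_nth c m \<noteq> 0" using c(2) by (auto simp: fps_eq_iff)
  then have vm: "v m > 0" using r by (simp add: v_def)
  obtain N where N: "\<And>n. n \<ge> N \<Longrightarrow> v n < v m"
    using tate_eventually [OF c(1) vm] unfolding v_def by blast
  define M where "M = Max (v ` {..<max N (Suc m)})"
  have M: "v n \<le> M" for n
  proof (cases "n < N")
    case True
    then show ?thesis unfolding M_def by (intro Max_ge) auto
  next
    case False
    moreover have "v m \<le> M" unfolding M_def by (intro Max_ge) auto
    ultimately show ?thesis using N [of n] by simp
  qed
  have "M \<in> v ` {..<max N (Suc m)}" unfolding M_def by (intro Max_in) (auto simp: lessThan_empty_iff)
  then obtain d0 where d0: "v d0 = M" by auto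
  have bound: "n < N" if "v n = M" for n
    using N [of n] M [of m] that by (meson leD not_less)
  define d where "d = (GREATEST n. v n = M)"
  have d: "v d = M" unfolding d_def
    by (rule GreatestI_nat [of _ d0 N]) (use d0 bound in \<open>auto intro: less_imp_le\<close>)
  have less: "v n < M" if "n > d" for n
  proof (rule ccontr)
    assume "\<not> v n < M"
    then have "v n = M" using M [of n] by simp
    then have "n \<le> d" unfolding d_def
      by (intro Greatest_le_nat [of _ _ N]) (use bound in \<open>auto intro: less_imp_le\<close>)
    then show False using that by simp
  qed
  have "v d > 0" using vm M [of m] d by simp
  then have "fps_nth c d \<noteq> 0" by (auto simp: v_def)
  then show ?thesis using d M less unfolding weierstrass_degree_def v_def by metis
qed

text \<open>
  A strict bound on the terms passes to the sum, because the weighted coefficients attain their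
  supremum.
\<close>

lemma absval_fps_at_less:
  fixes c :: "'a::{nonarch_field,complete_space} fps"
  assumes r: "0 < r" and c: "tate r c" and x: "absval x \<le> r"
    and less: "\<And>n. absval (fps_nth c n) * r ^ n < M"
  shows "absval (fps_at c x) < M"
proof (cases "c = 0")
  case True
  then show ?thesis using less [of 0] fps_at_const [of 0 x] by simp
next
  case False
  then obtain d where d: "weierstrass_degree r c d" using ex_weierstrass_degree [OF r c] by blast
  have "absval (fps_at c x) \<le> absval (fps_nth c d) * r ^ d"
    using d by (intro absval_fps_at_le [OF c x]) (simp add: weierstrass_degree_def gauss_le_def)
  also have "\<dots> < M" by (rule less)
  finally show ?thesis .
qed

lemma absval_fps_quotient_less:
  fixes c :: "'a::{nonarch_field,complete_space} fps"
  assumes r: "0 < r" and c: "tate r c" and x: "absval x \<le> r"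
    and less: "\<And>k. k > n \<Longrightarrow> absval (fps_nth c k) * r ^ k < M"
  shows "absval (fps_nth (fps_quotient c x) n) * r ^ Suc n < M"
proof -
  have "absval (fps_nth (fps_quotient c x) n) < M / r ^ Suc n"
    unfolding fps_quotient_def fps_nth_Abs_fps
  proof (rule absval_fps_at_less [OF r tate_shift [OF r c] x])
    fix k
    show "absval (fps_nth (fps_shift (Suc n) c) k) * r ^ k < M / r ^ Suc n"
      using less [of "k + Suc n"] r by (simp add: field_simps power_add)
  qed
  then show ?thesis using r by (simp add: field_simps)
qed

lemma absval_fps_at_weierstrass_degree_0:
  fixes c :: "'a::{nonarch_field,complete_space} fps"
  assumes r: "0 < r" and c: "tate r c" and x: "absval x \<le> r"
    and less: "\<And>n. n > 0 \<Longrightarrow> absval (fps_nth c n) * r ^ n < absval (fps_nth c 0)"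
  shows "absval (fps_at c x) = absval (fps_nth c 0)"
proof -
  have "absval (fps_nth (fps_quotient c x) 0) * r ^ Suc 0 < absval (fps_nth c 0)"
    by (intro absval_fps_quotient_less [OF r c x] less)
  moreover have "absval x * absval (fps_nth (fps_quotient c x) 0)
      \<le> r * absval (fps_nth (fps_quotient c x) 0)"
    using x by (intro mult_right_mono) auto
  ultimately have "absval (x * fps_nth (fps_quotient c x) 0) < absval (fps_nth c 0)"
    by (simp add: absval_mult mult.commute)
  moreover have "fps_at c x = fps_nth c 0 + x * fps_nth (fps_quotient c x) 0"
    using fps_at_shift [OF r c x] by (simp add: fps_quotient_def)
  ultimately show ?thesis by (simp add: absval_add_eq_left)
qed

text \<open>
  The coefficient \<open>d\<close> of the quotient is \<open>c\<^sub>d\<^sub>+\<^sub>1\<close> up to strictly smaller terms.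
  Coefficients below it are bounded by the maximal weight in \<open>c\<close>, and those above it only involve
  coefficients of \<open>c\<close> beyond the last maximal one.
\<close>

lemma weierstrass_degree_quotient:
  fixes c :: "'a::{nonarch_field,complete_space} fps"
  assumes r: "0 < r" and c: "tate r c" and x: "absval x \<le> r"
    and d: "weierstrass_degree r c (Suc d)"
  shows "weierstrass_degree r (fps_quotient c x) d"
proof -
  let ?q = "fps_quotient c x" and ?M = "absval (fps_nth c (Suc d)) * r ^ Suc d"
  have M: "?M > 0" using d r by (simp add: weierstrass_degree_def)
  have le: "absval (fps_nth ?q n) * r ^ Suc n \<le> ?M" for n
    using d M by (intro absval_fps_quotient_le [OF r c x]) (auto simp: weierstrass_degree_def)
  have less: "absval (fps_nth ?q n) * r ^ Suc n < ?M" if "n > d" for n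
    using d that by (intro absval_fps_quotient_less [OF r c x]) (auto simp: weierstrass_degree_def)
  have "absval (x * fps_nth ?q (Suc d)) * r ^ Suc d \<le> absval (fps_nth ?q (Suc d)) * r ^ Suc (Suc d)"
    using x r by (simp add: absval_mult mult_right_mono mult_left_mono mult.assoc mult.left_commute)
  also have "\<dots> < ?M" by (rule less) simp
  finally have "absval (x * fps_nth ?q (Suc d)) < absval (fps_nth c (Suc d))"
    using r by (simp add: mult_less_cancel_right)
  then have eq: "absval (fps_nth ?q d) = absval (fps_nth c (Suc d))"
    by (simp add: fps_quotient_nth [OF r c x, of d] absval_add_eq_left)
  have "fps_nth ?q d \<noteq> 0" using eq M absval_eq_0_iff by (metis mult_zero_left less_irrefl)
  moreover have "absval (fps_nth ?q n) * r ^ n \<le> absval (fps_nth ?q d) * r ^ d" for n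
    using le [of n] r eq by (simp add: mult.left_commute [of _ r])
  moreover have "absval (fps_nth ?q n) * r ^ n < absval (fps_nth ?q d) * r ^ d" if "n > d" for n
    using less [OF that] r eq by (simp add: mult.left_commute [of _ r])
  ultimately show ?thesis by (simp add: weierstrass_degree_def)
qed

text \<open>
  Strassmann's theorem: splitting off a zero lowers the Weierstrass degree, and a series of degree
  \<open>0\<close> has constant nonzero absolute value.
\<close>

lemma finite_zeros:
  fixes c :: "'a::{nonarch_field,complete_space} fps"
  assumes r: "0 < r" and c: "tate r c" "c \<noteq> 0"
  shows "finite {x. absval x \<le> r \<and> fps_at c x = 0}"
proof -
  have "finite {x. absval x \<le> r \<and> fps_at c x = 0}" if "tate r c" "weierstrass_degree r c d" for c :: "'a fps" and d
    using that
  proof (induction d arbitrary: c)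
    case 0
    have "fps_at c x \<noteq> 0" if "absval x \<le> r" for x
    proof -
      have "absval (fps_at c x) = absval (fps_nth c 0)"
        using 0 by (intro absval_fps_at_weierstrass_degree_0 [OF r _ that]) (auto simp: weierstrass_degree_def)
      then show ?thesis using 0(2) unfolding weierstrass_degree_def by (metis absval_eq_0_iff)
    qed
    then have "{x. absval x \<le> r \<and> fps_at c x = 0} = {}" by blast
    then show ?case by (simp only: finite.emptyI)
  next
    case (Suc d)
    show ?case
    proof (cases "\<exists>x. absval x \<le> r \<and> fps_at c x = 0")
      case True
      then obtain x where x: "absval x \<le> r" "fps_at c x = 0" by blast
      have "{y. absval y \<le> r \<and> fps_at c y = 0} \<subseteq>
          insert x {y. absval y \<le> r \<and> fps_at (fps_quotient c x) y = 0}"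
        using fps_at_quotient [OF r Suc.prems(1) x(1)] x(2) by auto
      then show ?thesis
        using Suc.IH [OF tate_quotient [OF r Suc.prems(1) x(1)]
            weierstrass_degree_quotient [OF r Suc.prems(1) x(1) Suc.prems(2)]]
        by (meson finite_insert finite_subset)
    next
      case False
      then have "{x. absval x \<le> r \<and> fps_at c x = 0} = {}" by blast
      then show ?thesis by (simp only: finite.emptyI)
    qed
  qed
  then show ?thesis using ex_weierstrass_degree [OF assms] c(1) by blast
qed

text \<open>
  Splitting off the factor \<open>X - x\<close> as long as \<open>x\<close> is a zero stops, as each time the
  Weierstrass degree drops.
\<close>

lemma zero_multiplicity:
  fixes c :: "'a::{nonarch_field,complete_space} fps"
  assumes r: "0 < r" and c: "tate r c" "c \<noteq> 0" and x: "absval x \<le> r"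
  obtains m u where "tate r u" "fps_at u x \<noteq> 0"
    "\<And>y. absval y \<le> r \<Longrightarrow> fps_at c y = (y - x) ^ m * fps_at u y"
proof -
  have "\<exists>m u. tate r u \<and> fps_at u x \<noteq> 0 \<and>
      (\<forall>y. absval y \<le> r \<longrightarrow> fps_at c y = (y - x) ^ m * fps_at u y)"
    if "tate r c" "weierstrass_degree r c d" for c :: "'a fps" and d
    using that
  proof (induction d arbitrary: c)
    case 0
    have "absval (fps_at c x) = absval (fps_nth c 0)"
      using 0 by (intro absval_fps_at_weierstrass_degree_0 [OF r _ x]) (auto simp: weierstrass_degree_def)
    then have "fps_at c x \<noteq> 0" using 0(2) unfolding weierstrass_degree_def by (metis absval_eq_0_iff)
    then show ?case using 0(1) by (intro exI [of _ 0] exI [of _ c]) simp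
  next
    case (Suc d)
    show ?case
    proof (cases "fps_at c x = 0")
      case True
      obtain m u where mu: "tate r u" "fps_at u x \<noteq> 0"
        "\<And>y. absval y \<le> r \<Longrightarrow> fps_at (fps_quotient c x) y = (y - x) ^ m * fps_at u y"
        using Suc.IH [OF tate_quotient [OF r Suc.prems(1) x]
            weierstrass_degree_quotient [OF r Suc.prems(1) x Suc.prems(2)]] by blast
      have "fps_at c y = (y - x) ^ Suc m * fps_at u y" if "absval y \<le> r" for y
        using fps_at_quotient [OF r Suc.prems(1) x that] True mu(3) [OF that] by (simp add: mult.assoc)
      then show ?thesis using mu by blast
    next
      case False
      then show ?thesis using Suc.prems(1) by (intro exI [of _ 0] exI [of _ c]) simp
    qed
  qed
  then show ?thesis using ex_weierstrass_degree [OF r c] c(1) that by blast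
qed

section \<open>Zeros over an algebraically closed field\<close>

text \<open>
  If all roots lay outside the disc, the polynomial would be a product of linear factors whose
  constant term dominates on the disc, and this domination is inherited by products.
\<close>

lemma poly_root_in_disc:
  fixes p :: "'a::{nonarch_field,alg_closed_field} poly"
  assumes n: "n > 0" and s: "0 \<le> s" and p: "coeff p n \<noteq> 0"
    and le: "absval (coeff p 0) \<le> absval (coeff p n) * s ^ n"
  shows "\<exists>x. absval x \<le> s \<and> poly p x = 0"
proof (rule ccontr)
  assume no_root: "\<not> ?thesis"
  \<comment> \<open>domination by the constant coefficient on the disc of radius \<open>s\<close>\<close>
  define S where "S = (\<lambda>q :: 'a poly. coeff q 0 \<noteq> 0 \<and>
      (\<forall>k>0. absval (coeff q k) * s ^ k < absval (coeff q 0)))"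
  have step: "S ([:- x, 1:] * q)" if q: "S q" and x: "absval x > s" for q x
    unfolding S_def
  proof (intro conjI allI impI)
    show "coeff ([:- x, 1:] * q) 0 \<noteq> 0" using q x s by (auto simp: S_def)
    fix k :: nat assume k: "k > 0"
    then obtain j where j: "k = Suc j" by (cases k) auto
    have pos: "absval (coeff q 0) > 0" "absval x > 0" using q x s by (auto simp: S_def)
    have "absval (x * coeff q k) * s ^ k < absval x * absval (coeff q 0)"
      using q k pos mult_strict_left_mono [of "absval (coeff q k) * s ^ k" "absval (coeff q 0)" "absval x"]
      by (simp add: S_def absval_mult mult.assoc)
    moreover have "absval (coeff q j) * s ^ k < absval x * absval (coeff q 0)"
    proof -
      have "absval (coeff q j) * s ^ j \<le> absval (coeff q 0)"
        using q by (cases "j = 0") (auto simp: S_def less_imp_le)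
      then have "s * (absval (coeff q j) * s ^ j) \<le> s * absval (coeff q 0)"
        using s by (intro mult_left_mono)
      also have "\<dots> < absval x * absval (coeff q 0)" using x pos by simp
      finally show ?thesis by (simp add: j mult.left_commute)
    qed
    moreover have "coeff ([:- x, 1:] * q) k = coeff q j - x * coeff q k"
      using j by simp
    moreover have "coeff ([:- x, 1:] * q) 0 = - x * coeff q 0" by simp
    ultimately show "absval (coeff ([:- x, 1:] * q) k) * s ^ k < absval (coeff ([:- x, 1:] * q) 0)"
      using absval_diff [of "coeff q j" "x * coeff q k"] s
        mult_right_mono [OF absval_diff [of "coeff q j" "x * coeff q k"], of "s ^ k"]
      by (auto simp: absval_mult max_def split: if_splits)
  qed
  have p0: "p \<noteq> 0" using p by auto
  obtain A where A: "p = smult (lead_coeff p) (\<Prod>x\<in>#A. [:- x, 1:])"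
    using alg_closed_imp_factorization [OF p0] by blast
  have "poly p x = 0" if x: "x \<in># A" for x
  proof -
    obtain B where B: "A = add_mset x B" using multi_member_split [OF x] by blast
    have "poly (smult (lead_coeff p) (\<Prod>x\<in>#A. [:- x, 1:])) x = 0" unfolding B by simp
    then show ?thesis using A by simp
  qed
  then have out: "absval x > s" if "x \<in># A" for x using no_root that by (meson not_le)
  have "S (\<Prod>x\<in>#A. [:- x, 1:])"
    using out
  proof (induction A)
    case empty
    then show ?case by (simp add: S_def)
  next
    case (add x A)
    then have "S ([:- x, 1:] * (\<Prod>x\<in>#A. [:- x, 1:]))" by (intro step) auto
    then show ?case by simp
  qed
  moreover have "lead_coeff p \<noteq> 0" using p0 by simp
  ultimately have "S (smult (lead_coeff p) (\<Prod>x\<in>#A. [:- x, 1:]))"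
    by (simp add: S_def absval_mult mult.assoc)
  then have "S p" using A by simp
  then have "absval (coeff p n) * s ^ n < absval (coeff p 0)" using n by (simp add: S_def)
  then show False using le by simp
qed

text \<open>
  A truncation of \<open>c\<close> that is small at a point \<open>x\<close> of the disc has a root near \<open>x\<close>. Recentring the
  truncation at \<open>x\<close> does not change the absolute value of its coefficient of index \<open>d\<close>, the
  Weierstrass degree; the constant coefficient becomes the value at \<open>x\<close>, and the
  comparison of the two locates a root.
\<close>

lemma partial_sum_root_near:
  fixes c :: "'a::{nonarch_field,alg_closed_field} fps"
  assumes r: "0 < r" and d: "weierstrass_degree r c d" "0 < d" and N: "d \<le> N" and x: "absval x \<le> r"
  shows "\<exists>y. (\<Sum>k\<le>N. fps_nth c k * y ^ k) = 0 \<and>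
    absval (fps_nth c d) * absval (y - x) ^ d \<le> absval (\<Sum>k\<le>N. fps_nth c k * x ^ k)"
proof -
  \<comment> \<open>the truncation, recentred at \<open>x\<close>\<close>
  define Q where "Q = (\<Sum>k\<le>N. smult (fps_nth c k) ([:x, 1:] ^ k))"
  have Q: "poly Q z = (\<Sum>k\<le>N. fps_nth c k * (z + x) ^ k)" for z
    by (simp add: Q_def poly_sum add.commute)
  define T where "T = (\<Sum>k\<in>{d<..N}. fps_nth c k * (of_nat (k choose d) * x ^ (k - d)))"
  have "coeff Q d = (\<Sum>k\<in>{d..N}. fps_nth c k * coeff ([:x, 1:] ^ k) d)"
    unfolding Q_def coeff_sum coeff_smult
    by (rule sum.mono_neutral_right) (auto simp: coeff_eq_0 degree_linear_power)
  also have "\<dots> = (\<Sum>k\<in>{d..N}. fps_nth c k * (of_nat (k choose d) * x ^ (k - d)))"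
    by (rule sum.cong) (auto simp: coeff_linear_poly_power)
  also have "{d..N} = insert d {d<..N}" using N by auto
  finally have coeff_d: "coeff Q d = fps_nth c d + T" by (simp add: T_def)
  have "absval T < absval (fps_nth c d)"
    unfolding T_def
  proof (rule absval_sum_less)
    show "0 < absval (fps_nth c d)" using d by (simp add: weierstrass_degree_def)
    fix k assume k: "k \<in> {d<..N}"
    have "absval (fps_nth c k * (of_nat (k choose d) * x ^ (k - d))) \<le> absval (fps_nth c k) * (1 * r ^ (k - d))"
      unfolding absval_mult absval_power
      using x by (intro mult_mono power_mono absval_of_nat_le_one) auto
    also have "\<dots> < absval (fps_nth c d)"
    proof -
      have "absval (fps_nth c k) * r ^ k < absval (fps_nth c d) * r ^ d"
        using d k by (auto simp: weierstrass_degree_def)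
      moreover have "r ^ k = r ^ (k - d) * r ^ d" using k by (simp flip: power_add)
      ultimately show ?thesis using r by (simp add: mult.assoc [symmetric] mult_less_cancel_right)
    qed
    finally show "absval (fps_nth c k * (of_nat (k choose d) * x ^ (k - d))) < absval (fps_nth c d)" .
  qed
  then have cd: "absval (coeff Q d) = absval (fps_nth c d)"
    unfolding coeff_d by (rule absval_add_eq_left)
  then have nz: "coeff Q d \<noteq> 0" using d by (metis absval_eq_0_iff weierstrass_degree_def)
  \<comment> \<open>the radius at which the term of index \<open>d\<close> balances the constant term\<close>
  define s where "s = root d (absval (poly Q 0) / absval (coeff Q d))"
  have s: "0 \<le> s" "s ^ d = absval (poly Q 0) / absval (coeff Q d)"
    using d(2) by (auto simp: s_def real_root_pow_pos2 real_root_ge_zero)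
  obtain z where z: "absval z \<le> s" "poly Q z = 0"
    using poly_root_in_disc [OF d(2) s(1) nz] s(2) nz by (auto simp: poly_0_coeff_0)
  have "absval (fps_nth c d) * absval z ^ d \<le> absval (fps_nth c d) * s ^ d"
    using z by (intro mult_left_mono power_mono) auto
  also have "\<dots> = absval (poly Q 0)"
    using s(2) nz by (simp flip: cd)
  finally show ?thesis
    using z(2) by (intro exI [of _ "z + x"]) (simp add: Q)
qed

lemma absval_power_diff_le:
  assumes "absval (x::'a::nonarch_field) \<le> r" "absval y \<le> r"
  shows "absval (y ^ k - x ^ k) * r \<le> absval (y - x) * r ^ k"
proof (cases k)
  case (Suc n)
  have r: "0 \<le> r" using assms(1) absval_nonneg order_trans by blast
  have "absval (\<Sum>p<Suc n. y ^ p * x ^ (n - p)) \<le> r ^ n"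
  proof (rule absval_sum_le)
    fix p assume "p \<in> {..<Suc n}"
    then have "r ^ n = r ^ p * r ^ (n - p)" by (simp flip: power_add)
    then show "absval (y ^ p * x ^ (n - p)) \<le> r ^ n"
      using assms r by (simp add: absval_mult absval_power mult_mono power_mono)
  qed (use r in simp)
  then have "absval (y - x) * absval (\<Sum>p<Suc n. y ^ p * x ^ (n - p)) * r
      \<le> absval (y - x) * r ^ n * r"
    using r by (intro mult_right_mono mult_left_mono) auto
  then show ?thesis
    unfolding Suc diff_power_eq_sum absval_mult by (simp add: mult_ac)
qed simp

text \<open>
  A root of one truncation is an approximate root of the next one, which by
  \<open>partial_sum_root_near\<close> has a root close by. The roots so chosen form a Cauchy sequence, and
  its limit is a zero of the series.
\<close>

lemma ex_zero_of_weierstrass_degree: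
  fixes c :: "'a::{nonarch_field,complete_space,alg_closed_field} fps"
  assumes r: "0 < r" and c: "tate r c" and d: "weierstrass_degree r c d" "0 < d"
  shows "\<exists>x. absval x \<le> r \<and> fps_at c x = 0"
proof -
  define P where "P = (\<lambda>N x. \<Sum>k\<le>N. fps_nth c k * x ^ k)"
  define M where "M = absval (fps_nth c d)"
  have M: "M > 0" using d by (simp add: M_def weierstrass_degree_def)
  have le: "absval (fps_nth c n) * r ^ n \<le> M * r ^ d" for n
    using d by (simp add: M_def weierstrass_degree_def)
  have near: "\<exists>y. absval y \<le> r \<and> P N y = 0 \<and> M * absval (y - x) ^ d \<le> absval (P N x)"
    if N: "d \<le> N" and x: "absval x \<le> r" and Px: "absval (P N x) \<le> M * r ^ d" for N x
  proof -
    obtain y where y: "P N y = 0" "M * absval (y - x) ^ d \<le> absval (P N x)"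
      using partial_sum_root_near [OF r d N x] unfolding P_def M_def by blast
    then have "M * absval (y - x) ^ d \<le> M * r ^ d" using Px by linarith
    then have "absval (y - x) ^ d \<le> r ^ d" using M by simp
    then have "absval (y - x) \<le> r" using d(2) r power_mono_iff [of "absval (y - x)" r d] by simp
    then have "absval y \<le> r" using absval_add_le [of "y - x" r x] x by simp
    then show ?thesis using y by blast
  qed
  have P0: "P N 0 = fps_nth c 0" for N
  proof -
    have "P N 0 = (\<Sum>k\<in>{0}. fps_nth c k * 0 ^ k)"
      unfolding P_def by (rule sum.mono_neutral_right) auto
    then show ?thesis by simp
  qed
  obtain x0 where x0: "absval x0 \<le> r" "P d x0 = 0"
    using near [of d 0] le [of 0] r by (auto simp: P0)
  \<comment> \<open>The value of the next truncation at a root of the current one is the single new term,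
      so the distance to the next root is controlled by a coefficient that tends to zero.\<close>
  have "\<exists>X. \<forall>n. (absval (X n) \<le> r \<and> P (d + n) (X n) = 0) \<and>
      M * absval (X (Suc n) - X n) ^ d \<le> absval (fps_nth c (Suc (d + n))) * r ^ Suc (d + n)"
  proof (rule dependent_nat_choice)
    show "\<exists>x. absval x \<le> r \<and> P (d + 0) x = 0" using x0 by auto
    fix x n assume x: "absval x \<le> r \<and> P (d + n) x = 0"
    have "P (d + Suc n) x = fps_nth c (Suc (d + n)) * x ^ Suc (d + n)"
      using x by (simp add: P_def)
    then have small: "absval (P (d + Suc n) x) \<le> absval (fps_nth c (Suc (d + n))) * r ^ Suc (d + n)"
      using absval_term_le [of x r] x by metis
    then show "\<exists>y. (absval y \<le> r \<and> P (d + Suc n) y = 0) \<and>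
        M * absval (y - x) ^ d \<le> absval (fps_nth c (Suc (d + n))) * r ^ Suc (d + n)"
      using near [of "d + Suc n" x] le [of "Suc (d + n)"] x by force
  qed
  then obtain X where X: "\<And>n. absval (X n) \<le> r" "\<And>n. P (d + n) (X n) = 0"
    "\<And>n. M * absval (X (Suc n) - X n) ^ d \<le> absval (fps_nth c (Suc (d + n))) * r ^ Suc (d + n)"
    by blast
  have "(\<lambda>n. absval (X (Suc n) - X n)) \<longlonglongrightarrow> 0"
  proof (rule LIMSEQ_I)
    fix e :: real assume e: "e > 0"
    then have "M * e ^ d > 0" using M by simp
    then obtain N where N: "\<And>n. n \<ge> N \<Longrightarrow> absval (fps_nth c n) * r ^ n < M * e ^ d"
      using tate_eventually [OF c] by blast
    have "norm (absval (X (Suc n) - X n) - 0) < e" if "n \<ge> N" for n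
    proof -
      have "M * absval (X (Suc n) - X n) ^ d < M * e ^ d"
        using X(3) [of n] N [of "Suc (d + n)"] that by linarith
      then have "absval (X (Suc n) - X n) ^ d < e ^ d" using M by simp
      then have "absval (X (Suc n) - X n) < e" by (rule power_less_imp_less_base) (use e in simp)
      then show ?thesis by simp
    qed
    then show "\<exists>N. \<forall>n\<ge>N. norm (absval (X (Suc n) - X n) - 0) < e" by blast
  qed
  then have "Cauchy X" by (rule Cauchy_of_consecutive)
  then obtain x where lim: "X \<longlonglongrightarrow> x" using Cauchy_convergent unfolding convergent_def by blast
  have x: "absval x \<le> r" by (rule absval_le_of_tendsto [OF lim]) (simp add: X(1))
  have bound: "absval (P (d + n) x) \<le> M * r ^ d / r * absval (X n - x)" for n
  proof -
    have "P (d + n) x - P (d + n) (X n) = (\<Sum>k\<le>d + n. fps_nth c k * (x ^ k - X n ^ k))"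
      by (simp add: P_def sum_subtractf right_diff_distrib)
    also have "absval \<dots> \<le> M * r ^ d / r * absval (X n - x)"
    proof (rule absval_sum_le)
      fix k
      have "absval (fps_nth c k) * (absval (x ^ k - X n ^ k) * r)
          \<le> absval (fps_nth c k) * (absval (x - X n) * r ^ k)"
        by (intro mult_left_mono absval_power_diff_le X(1) x absval_nonneg)
      also have "\<dots> \<le> absval (x - X n) * (M * r ^ d)"
        using mult_left_mono [OF le [of k] absval_nonneg [of "x - X n"]] by (simp add: mult_ac)
      finally have "absval (fps_nth c k * (x ^ k - X n ^ k)) * r \<le> M * r ^ d * absval (X n - x)"
        unfolding absval_mult absval_minus_commute [of x "X n"] by (simp only: mult_ac)
      then show "absval (fps_nth c k * (x ^ k - X n ^ k)) \<le> M * r ^ d / r * absval (X n - x)"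
        using pos_le_divide_eq [OF r] by simp
    qed (use M r in simp)
    finally show ?thesis by (simp add: X(2))
  qed
  have bound_lim: "(\<lambda>n. M * r ^ d / r * absval (X n - x)) \<longlonglongrightarrow> 0"
    using tendsto_mult_left [OF lim [unfolded tendsto_absval_iff [of X]], of "M * r ^ d / r"] by simp
  have "(\<lambda>n. absval (P (d + n) x)) \<longlonglongrightarrow> 0"
    by (rule tendsto_sandwich [OF always_eventually always_eventually tendsto_const bound_lim])
      (simp_all add: bound del: times_divide_eq_left)
  then have 1: "(\<lambda>n. P (d + n) x) \<longlonglongrightarrow> 0"
    using tendsto_absval_iff [of "\<lambda>n. P (d + n) x" 0] by simp
  have "(\<lambda>n. P n x) \<longlonglongrightarrow> fps_at c x"
    using fps_at_sums [OF c x] by (simp add: sums_def_le P_def)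
  then have "(\<lambda>n. P (d + n) x) \<longlonglongrightarrow> fps_at c x"
    using LIMSEQ_ignore_initial_segment [of "\<lambda>n. P n x" _ d] by (simp add: add.commute)
  then have "fps_at c x = 0" using 1 LIMSEQ_unique by blast
  then show ?thesis using x by blast
qed

lemma ex_zero:
  fixes c :: "'a::{nonarch_field,complete_space,alg_closed_field} fps"
  assumes r: "0 < r" and c: "tate r c" and n: "0 < n"
    and le: "absval (fps_nth c 0) \<le> absval (fps_nth c n) * r ^ n"
  shows "\<exists>x. absval x \<le> r \<and> fps_at c x = 0"
proof (cases "fps_nth c 0 = 0")
  case True
  then show ?thesis using r by (intro exI [of _ 0]) (simp add: fps_at_0)
next
  case False
  then have "c \<noteq> 0" by auto
  then obtain d where d: "weierstrass_degree r c d" using ex_weierstrass_degree [OF r c] by blast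
  have "d \<noteq> 0"
  proof
    assume "d = 0"
    then have "absval (fps_nth c n) * r ^ n < absval (fps_nth c 0)"
      using d n by (simp add: weierstrass_degree_def)
    then show False using le by simp
  qed
  then show ?thesis using ex_zero_of_weierstrass_degree [OF r c d] by simp
qed

section \<open>The compositional inverse\<close>

lemma gauss_le_mono: "gauss_le r c M \<Longrightarrow> M \<le> N \<Longrightarrow> gauss_le r c N"
  unfolding gauss_le_def using order_trans by blast

lemma gauss_le_power_diff:
  assumes r: "0 < r" and \<phi>: "gauss_le r \<phi> r" and \<psi>: "gauss_le r \<psi> r"
    and \<delta>: "gauss_le r (\<phi> - \<psi>) \<delta>"
  shows "gauss_le r (\<phi> ^ k - \<psi> ^ k) (\<delta> * r ^ k / r)"
proof (cases k)
  case 0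
  then show ?thesis using gauss_le_nonneg [OF \<delta>] r by (simp add: gauss_le_zero)
next
  case (Suc m)
  have "gauss_le r (\<Sum>p<Suc m. \<phi> ^ p * \<psi> ^ (m - p)) (r ^ m)"
  proof (rule gauss_le_sum)
    fix p assume "p \<in> {..<Suc m}"
    then have eq: "r ^ m = r ^ p * r ^ (m - p)" by (simp flip: power_add)
    show "gauss_le r (\<phi> ^ p * \<psi> ^ (m - p)) (r ^ m)"
      unfolding eq using r \<phi> \<psi> by (intro gauss_le_mult gauss_le_power) auto
  qed (use r in auto)
  then have "gauss_le r ((\<phi> - \<psi>) * (\<Sum>p<Suc m. \<phi> ^ p * \<psi> ^ (m - p))) (\<delta> * r ^ m)"
    using r \<delta> by (intro gauss_le_mult) auto
  then show ?thesis unfolding Suc diff_power_eq_sum using r by simp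
qed

text \<open>
  The contraction estimate: if the Gauss norm of \<open>G\<close> is at most \<open>\<theta> r\<close>, substitution into \<open>G\<close> of
  series with Gauss norm at most \<open>r\<close> is Lipschitz with constant \<open>\<theta>\<close>. A difference of powers
  \<open>\<phi> ^ i - \<psi> ^ i\<close> gains a factor \<open>r ^ (i - 1)\<close>, which the weight of the \<open>i\<close>-th coefficient of
  \<open>G\<close> absorbs.
\<close>

lemma gauss_le_compose_diff:
  assumes r: "0 < r" and G: "gauss_le r G (\<theta> * r)"
    and \<phi>: "gauss_le r \<phi> r" and \<psi>: "gauss_le r \<psi> r" and \<delta>: "gauss_le r (\<phi> - \<psi>) \<delta>"
  shows "gauss_le r ((G oo \<phi>) - (G oo \<psi>)) (\<theta> * \<delta>)"
  unfolding gauss_le_def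
proof
  fix n
  have nn: "0 \<le> \<theta> * \<delta>"
    using gauss_le_nonneg [OF G] gauss_le_nonneg [OF \<delta>] r by (simp add: zero_le_mult_iff)
  have eq: "fps_nth ((G oo \<phi>) - (G oo \<psi>)) n = (\<Sum>i=0..n. fps_nth G i * fps_nth (\<phi> ^ i - \<psi> ^ i) n)"
    by (simp add: fps_compose_nth sum_subtractf right_diff_distrib)
  have "absval (fps_nth ((G oo \<phi>) - (G oo \<psi>)) n) \<le> \<theta> * \<delta> / r ^ n"
    unfolding eq
  proof (rule absval_sum_le)
    fix i
    have "absval (fps_nth G i) * (absval (fps_nth (\<phi> ^ i - \<psi> ^ i) n) * r ^ n)
        \<le> absval (fps_nth G i) * (\<delta> * r ^ i / r)"
      by (intro mult_left_mono gauss_leD gauss_le_power_diff r \<phi> \<psi> \<delta> absval_nonneg)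
    also have "\<dots> = (absval (fps_nth G i) * r ^ i) * (\<delta> / r)" by simp
    also have "\<dots> \<le> (\<theta> * r) * (\<delta> / r)"
      using gauss_le_nonneg [OF \<delta>] r by (intro mult_right_mono gauss_leD [OF G]) auto
    also have "\<dots> = \<theta> * \<delta>" using r by simp
    finally have "absval (fps_nth G i * fps_nth (\<phi> ^ i - \<psi> ^ i) n) * r ^ n \<le> \<theta> * \<delta>"
      unfolding absval_mult by (simp only: mult.assoc)
    then show "absval (fps_nth G i * fps_nth (\<phi> ^ i - \<psi> ^ i) n) \<le> \<theta> * \<delta> / r ^ n"
      using pos_le_divide_eq [of "r ^ n"] r by simp
  qed (use nn r in simp)
  then show "absval (fps_nth ((G oo \<phi>) - (G oo \<psi>)) n) * r ^ n \<le> \<theta> * \<delta>"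
    using pos_le_divide_eq [of "r ^ n"] r by simp
qed

text \<open>
  In a power with exponent at least \<open>2\<close> of a series without constant term, the coefficient of
  index \<open>n\<close> only sees coefficients of smaller index. This makes the fixed point equation for an
  inverse series a recursion.
\<close>

lemma fps_power_nth_cutoff:
  fixes c :: "'a::comm_ring_1 fps"
  assumes c0: "fps_nth c 0 = 0" and k: "k \<ge> 2"
  shows "fps_nth (c ^ k) n = fps_nth (fps_cutoff n c ^ k) n"
proof -
  obtain m where m: "k = Suc m" "m \<ge> 1" using k by (cases k) auto
  define S where "S = (\<Sum>p<Suc m. c ^ p * fps_cutoff n c ^ (m - p))"
  have "fps_nth (fps_cutoff n c) 0 = 0" using c0 by simp
  then have "fps_nth (c ^ p * fps_cutoff n c ^ (m - p)) 0 = 0" if "p < Suc m" for p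
    using m(2) c0 that by (cases "p = 0") (simp_all add: fps_power_zeroth power_0_left)
  then have S0: "fps_nth S 0 = 0" by (simp add: S_def fps_sum_nth del: sum.lessThan_Suc)
  have "fps_nth (c ^ k - fps_cutoff n c ^ k) n = fps_nth ((c - fps_cutoff n c) * S) n"
    unfolding m(1) diff_power_eq_sum S_def ..
  also have "\<dots> = (\<Sum>i=0..n. fps_nth (c - fps_cutoff n c) i * fps_nth S (n - i))"
    by (rule fps_mult_nth)
  also have "\<dots> = 0"
  proof (rule sum.neutral, rule ballI)
    fix i assume "i \<in> {0..n}"
    then show "fps_nth (c - fps_cutoff n c) i * fps_nth S (n - i) = 0"
      using S0 by (cases "i = n") auto
  qed
  finally show ?thesis by simp
qed

lemma gauss_le_fixed_point:
  fixes G h :: "'a::nonarch_field fps"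
  assumes r: "0 < r" and G: "gauss_le r G r" "fps_nth G 0 = 0" "fps_nth G 1 = 0"
    and h: "fps_nth h 0 = 0" "h = fps_X - (G oo h)"
  shows "gauss_le r h r"
  unfolding gauss_le_def
proof
  fix n
  show "absval (fps_nth h n) * r ^ n \<le> r"
  proof (induction n rule: less_induct)
    case (less n)
    have cut: "gauss_le r (fps_cutoff n h) r"
      using less r by (auto simp: gauss_le_def)
    have "absval (fps_nth (G oo h) n) \<le> r / r ^ n"
      unfolding fps_compose_nth
    proof (rule absval_sum_le)
      fix i assume "i \<in> {0..n}"
      consider "i = 0" | "i = 1" | "i \<ge> 2" by linarith
      then show "absval (fps_nth G i * fps_nth (h ^ i) n) \<le> r / r ^ n"
      proof cases
        case 3
        have "absval (fps_nth (h ^ i) n) * r ^ n \<le> r ^ i"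
          unfolding fps_power_nth_cutoff [OF h(1) 3]
          using r cut by (intro gauss_leD gauss_le_power) auto
        then have "absval (fps_nth G i) * (absval (fps_nth (h ^ i) n) * r ^ n) \<le> absval (fps_nth G i) * r ^ i"
          by (intro mult_left_mono) auto
        also have "\<dots> \<le> r" by (rule gauss_leD [OF G(1)])
        finally have "absval (fps_nth G i * fps_nth (h ^ i) n) * r ^ n \<le> r"
          unfolding absval_mult by (simp only: mult.assoc)
        then show ?thesis using pos_le_divide_eq [of "r ^ n"] r by simp
      qed (use G r in simp_all)
    qed (use r in simp)
    moreover have "absval (fps_nth (fps_X :: 'a fps) n) \<le> r / r ^ n" using r by simp
    ultimately have "absval (fps_nth (fps_X - (G oo h)) n) \<le> r / r ^ n"
      unfolding fps_sub_nth by (intro absval_diff_le)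
    then have "absval (fps_nth h n) \<le> r / r ^ n" using h(2) by simp
    then show ?case using pos_le_divide_eq [of "r ^ n"] r by simp
  qed
qed

text \<open>
  With \<open>G = g - X\<close>, the inverse series \<open>h\<close> is the fixed point of \<open>\<phi> \<mapsto> X - G oo \<phi>\<close>. The Gauss norm of
  \<open>G\<close> is attained, so it is at most \<open>\<theta> r\<close> for some \<open>\<theta> < 1\<close>, and the iterates of
  this contraction approximate \<open>h\<close> in the Gauss norm.
\<close>

lemma tate_fps_inv:
  fixes g :: "'a::{nonarch_field,complete_space} fps"
  assumes r: "0 < r" and g: "tate r g" "fps_nth g 0 = 0" "fps_nth g 1 = 1"
    and less: "\<And>n. n \<ge> 2 \<Longrightarrow> absval (fps_nth g n) * r ^ n < r"
  shows "tate r (fps_inv g)" "gauss_le r (fps_inv g) r"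
proof -
  define G where "G = g - fps_X"
  define h where "h = fps_inv g"
  have G: "tate r G" "fps_nth G 0 = 0" "fps_nth G 1 = 0"
    using g r by (auto simp: G_def intro!: tate_diff tate_X)
  have G_less: "absval (fps_nth G n) * r ^ n < r" for n
  proof -
    consider "n = 0" | "n = 1" | "n \<ge> 2" by linarith
    then show ?thesis by cases (use G r less [of n] in \<open>auto simp: G_def\<close>)
  qed
  obtain \<theta> where \<theta>: "0 \<le> \<theta>" "\<theta> < 1" "gauss_le r G (\<theta> * r)"
  proof (cases "G = 0")
    case True
    then show ?thesis using that [of 0] by (simp add: gauss_le_zero)
  next
    case False
    then obtain d where "weierstrass_degree r G d" using ex_weierstrass_degree [OF r G(1)] by blast
    then have "gauss_le r G (absval (fps_nth G d) * r ^ d / r * r)"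
      using r by (simp add: weierstrass_degree_def gauss_le_def)
    then show ?thesis using that [of "absval (fps_nth G d) * r ^ d / r"] G_less [of d] r by simp
  qed
  have h0: "fps_nth h 0 = 0" by (simp add: h_def fps_inv_def)
  have "fps_X = g oo h" unfolding h_def using g by (simp add: fps_inv_right)
  also have "g = fps_X + G" by (simp add: G_def)
  finally have "fps_X = h + (G oo h)" using h0 by (simp add: fps_compose_add_distrib)
  then have h_eq: "h = fps_X - (G oo h)" by (simp only: eq_diff_eq)
  have h: "gauss_le r h r"
    using G_less by (intro gauss_le_fixed_point [OF r _ G(2,3) h0 h_eq]) (simp add: gauss_le_def less_imp_le)
  \<comment> \<open>the iterates of the contraction, started at \<open>0\<close>\<close>
  have approx: "\<exists>\<phi>. tate r \<phi> \<and> fps_nth \<phi> 0 = 0 \<and> gauss_le r \<phi> r \<and> gauss_le r (h - \<phi>) (\<theta> ^ j * r)" for j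
  proof (induction j)
    case 0
    then show ?case using h tate_const [of r 0] r by (intro exI [of _ 0]) (simp add: gauss_le_zero)
  next
    case (Suc j)
    then obtain \<phi> where \<phi>: "tate r \<phi>" "fps_nth \<phi> 0 = 0" "gauss_le r \<phi> r"
      "gauss_le r (h - \<phi>) (\<theta> ^ j * r)" by blast
    define \<phi>' where "\<phi>' = fps_X - (G oo \<phi>)"
    have "tate r \<phi>'"
      unfolding \<phi>'_def using r by (intro tate_diff tate_X tate_compose G(1) \<phi>) auto
    moreover have "fps_nth \<phi>' 0 = 0" using G(2) by (simp add: \<phi>'_def fps_compose_nth)
    moreover have close: "gauss_le r (h - \<phi>') (\<theta> ^ Suc j * r)"
    proof -
      have "h - \<phi>' = - ((G oo h) - (G oo \<phi>))" unfolding \<phi>'_def by (subst h_eq) simp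
      then show ?thesis
        using gauss_le_minus [OF gauss_le_compose_diff [OF r \<theta>(3) h \<phi>(3,4)]] by (simp add: mult.assoc)
    qed
    moreover have "gauss_le r \<phi>' r"
    proof -
      have "\<theta> ^ Suc j * r \<le> 1 * r"
        using \<theta> r by (intro mult_right_mono power_le_one) auto
      then have "gauss_le r (h - \<phi>') r" using gauss_le_mono [OF close] by simp
      then have "gauss_le r (h - (h - \<phi>')) r" by (rule gauss_le_diff [OF less_imp_le [OF r] h])
      then show ?thesis by simp
    qed
    ultimately show ?case by blast
  qed
  have "tate r h"
  proof (rule tate_approx)
    fix e :: real assume e: "e > 0"
    have "(\<lambda>j. \<theta> ^ j * r) \<longlonglongrightarrow> 0 * r"
      using \<theta> by (intro tendsto_mult tendsto_const LIMSEQ_realpow_zero) auto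
    then have "\<forall>\<^sub>F j in sequentially. \<theta> ^ j * r < e" using e by (intro order_tendstoD) auto
    then obtain j where "\<theta> ^ j * r < e" by (auto simp: eventually_sequentially)
    then show "\<exists>p. tate r p \<and> gauss_le r (h - p) e"
      using approx [of j] gauss_le_mono less_imp_le by blast
  qed (use r in simp)
  then show "tate r (fps_inv g)" "gauss_le r (fps_inv g) r" using h by (simp_all add: h_def)
qed

section \<open>The conjugacy on the closed disc\<close>

text \<open>
  Otherwise the series \<open>c / X\<close>, whose constant term is the coefficient of index \<open>1\<close>, has a zero by
  \<open>ex_zero\<close>; it is a zero of \<open>c\<close> other than the origin.
\<close>

lemma coeff_less_of_no_zeros:
  fixes c :: "'a::{nonarch_field,complete_space,alg_closed_field} fps"
  assumes r: "0 < r" and c: "tate r c" "fps_nth c 0 = 0" "fps_nth c 1 \<noteq> 0"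
    and no_zero: "\<And>x. absval x \<le> r \<Longrightarrow> fps_at c x = 0 \<Longrightarrow> x = 0"
    and n: "n \<ge> 2"
  shows "absval (fps_nth c n) * r ^ n < absval (fps_nth c 1) * r"
proof (rule ccontr)
  assume not_less: "\<not> ?thesis"
  obtain m where m: "n = Suc m" "m > 0" using n by (cases n) auto
  have "absval (fps_nth c 1) * r \<le> (absval (fps_nth c n) * r ^ m) * r"
    using not_less m(1) by (simp add: mult_ac)
  then have "absval (fps_nth (fps_shift 1 c) 0) \<le> absval (fps_nth (fps_shift 1 c) m) * r ^ m"
    using r m(1) by simp
  then obtain x where x: "absval x \<le> r" "fps_at (fps_shift 1 c) x = 0"
    using ex_zero [OF r tate_shift [OF r c(1)] m(2)] by blast
  then have "fps_at c x = 0" using fps_at_shift [OF r c(1) x(1)] c(2) by simp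
  then have "x = 0" using no_zero x(1) by blast
  then show False using x(2) c(3) by (simp add: fps_at_0)
qed

text \<open>
  Without further zeros, \<open>g\<close> is the identity up to terms of smaller Gauss norm; hence its
  inverse series converges on the same disc, maps it to itself, and inverts \<open>g\<close> there. Contrapositively,
  maximality of a smaller linearization disc forces \<open>g\<close> to have another zero.
\<close>

lemma full_conjugacy_on_cball:
  fixes f :: "'a::{nonarch_field,complete_space,alg_closed_field} fps"
  assumes r: "0 < r" and semi: "semi_conjugacy_on f (cball 0 r)"
    and g: "tate r (conjugacy_fps f)" "fps_nth (conjugacy_fps f) 0 = 0" "fps_nth (conjugacy_fps f) 1 = 1"
    and no_zero: "\<And>x. absval x \<le> r \<Longrightarrow> fps_at (conjugacy_fps f) x = 0 \<Longrightarrow> x = 0"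
  shows "full_conjugacy_on f (cball 0 r)"
proof -
  define g where "g = conjugacy_fps f"
  define h where "h = fps_inv g"
  note g = g [folded g_def] and no_zero = no_zero [folded g_def]
  have less: "absval (fps_nth g n) * r ^ n < r" if "n \<ge> 2" for n
    using coeff_less_of_no_zeros [OF r g(1,2) _ no_zero that] g(3) by simp
  have h: "tate r h" "gauss_le r h r" "fps_nth h 0 = 0"
    using tate_fps_inv [OF r g less] by (auto simp: h_def fps_inv_def)
  have g_le: "gauss_le r g r"
    unfolding gauss_le_def
  proof
    fix n :: nat
    consider "n = 0" | "n = 1" | "n \<ge> 2" by linarith
    then show "absval (fps_nth g n) * r ^ n \<le> r"
      by cases (use g r less [of n] in auto)
  qed
  have hg: "fps_at h (fps_at g x) = x" if "absval x \<le> r" for x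
    using fps_at_compose [OF r h(1) g(1,2) g_le that] g(2,3) by (simp add: h_def fps_inv fps_at_X)
  have gh: "fps_at g (fps_at h x) = x" if "absval x \<le> r" for x
    using fps_at_compose [OF r g(1) h(1,3,2) that] g(2,3) by (simp add: h_def fps_inv_right fps_at_X)
  have inj: "inj_on (fps_at g) (cball 0 r)"
    by (rule inj_on_inverseI [where g = "fps_at h"]) (simp add: hg mem_cball_0_iff del: mem_cball)
  have conv: "fps_converges g x" "fps_converges h x" if "absval x \<le> r" for x
    using tate_fps_converges g(1) h(1) that by blast+
  have semi': "fps_converges f x" "fps_converges g (fps_at f x)"
    "fps_at g (fps_at f x) = fps_nth f 1 * fps_at g x" if "absval x \<le> r" for x
    using semi that unfolding semi_conjugacy_on_def Let_def g_def
    by (auto simp: mem_cball_0_iff simp del: mem_cball)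
  have "absval (fps_at h x) \<le> r" if "absval x \<le> r" for x
    using absval_fps_at_le [OF h(1) that h(2)] .
  then show ?thesis
    unfolding full_conjugacy_on_def Let_def g_def [symmetric] h_def [symmetric]
    using inj conv semi' gh by (auto simp: mem_cball_0_iff simp del: mem_cball)
qed

text \<open>
  As \<open>f\<close> has no other zeros in the open disc, \<open>coeff_less_of_no_zeros\<close> applies with the radius
  \<open>absval x\<close>: at \<open>x\<close> the linear term strictly dominates all others.
\<close>

lemma absval_fps_at_eq_absval:
  fixes f :: "'a::{nonarch_field,complete_space,alg_closed_field} fps"
  assumes f: "tate r f" "fps_nth f 0 = 0" "absval (fps_nth f 1) = 1"
    and no_zero: "\<And>x. absval x < r \<Longrightarrow> fps_at f x = 0 \<Longrightarrow> x = 0"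
    and x: "absval x < r"
  shows "absval (fps_at f x) = absval x"
proof (cases "x = 0")
  case True
  then show ?thesis using f(2) by (simp add: fps_at_0)
next
  case False
  define \<rho> where "\<rho> = absval x"
  have \<rho>: "0 < \<rho>" "\<rho> < r" using False x by (auto simp: \<rho>_def)
  have f\<rho>: "tate \<rho> f" using tate_mono [OF f(1)] \<rho> by simp
  have "fps_nth f 1 \<noteq> 0" using f(3) by auto
  then have less: "absval (fps_nth f n) * \<rho> ^ n < \<rho>" if "n \<ge> 2" for n
    using coeff_less_of_no_zeros [OF \<rho>(1) f\<rho> f(2) _ _ that] no_zero \<rho>(2) f(3) by force
  have "absval (fps_at (fps_shift 1 f) x) = absval (fps_nth (fps_shift 1 f) 0)"
  proof (rule absval_fps_at_weierstrass_degree_0 [OF \<rho>(1) tate_shift [OF \<rho>(1) f\<rho>]])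
    fix n :: nat assume "n > 0"
    then have "(absval (fps_nth f (Suc n)) * \<rho> ^ n) * \<rho> < 1 * \<rho>" using less [of "Suc n"] by (simp add: mult_ac)
    then show "absval (fps_nth (fps_shift 1 f) n) * \<rho> ^ n < absval (fps_nth (fps_shift 1 f) 0)"
      using \<rho>(1) f(3) by simp
  qed (simp add: \<rho>_def)
  then show ?thesis
    using fps_at_shift [OF \<rho>(1) f\<rho>, of x] f(2,3) by (simp add: \<rho>_def absval_mult)
qed

text \<open>
  For \<open>z\<close> on the sphere, the series \<open>f - z\<close> has a constant and a linear term of the same weight, so
  \<open>ex_zero\<close> yields a preimage of \<open>z\<close> in the closed disc. It cannot lie in the open disc, where \<open>f\<close>
  preserves absolute values.
\<close>

lemma sphere_subset_image:
  fixes f :: "'a::{nonarch_field,complete_space,alg_closed_field} fps"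
  assumes r: "0 < r" and f: "tate r f" "fps_nth f 0 = 0" "absval (fps_nth f 1) = 1"
    and iso: "\<And>x. absval x < r \<Longrightarrow> absval (fps_at f x) = absval x"
    and z: "absval z = r"
  shows "\<exists>x. absval x = r \<and> fps_at f x = z"
proof -
  have "\<exists>x. absval x \<le> r \<and> fps_at (f - fps_const z) x = 0"
    by (rule ex_zero [where n = 1]) (use r f z in \<open>auto intro!: tate_diff tate_const\<close>)
  then obtain x where x: "absval x \<le> r" "fps_at (f - fps_const z) x = 0" by blast
  then have "fps_at f x = z"
    using fps_at_diff [OF f(1) tate_const x(1), of z] r by (simp add: fps_at_const)
  then show ?thesis using iso [of x] x(1) z by force
qed

section \<open>Periodic points and their multipliers\<close>

text \<open>
  A finite set covered by its image under \<open>F\<close> is mapped bijectively onto itself, so that every orbit in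
  it is a cycle.
\<close>

lemma finite_surjective_periodic:
  assumes Z: "finite Z" "Z \<subseteq> F ` Z" and z: "z \<in> Z"
  obtains \<kappa> :: nat where "\<kappa> > 0" "(F ^^ \<kappa>) z = z" "\<And>i. 0 < i \<Longrightarrow> i < \<kappa> \<Longrightarrow> (F ^^ i) z \<noteq> z"
    "\<And>i. (F ^^ i) z \<in> Z"
proof -
  have img: "F ` Z = Z"
    by (metis Z card_image_le card_seteq finite_imageI)
  then have inj: "inj_on F Z" using Z(1) by (simp add: eq_card_imp_inj_on)
  have orbit: "(F ^^ i) w \<in> Z" if "w \<in> Z" for i w
    by (induction i) (use img that in auto)
  have inj_iter: "inj_on (F ^^ i) Z" for i
  proof (induction i)
    case (Suc i)
    then show ?case
      unfolding inj_on_def using orbit by (simp add: inj_on_eq_iff [OF inj])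
  qed simp
  have "\<not> inj_on (\<lambda>i. (F ^^ i) z) (UNIV :: nat set)"
  proof
    assume "inj (\<lambda>i. (F ^^ i) z)"
    moreover have "finite (range (\<lambda>i. (F ^^ i) z))"
      using orbit [OF z] by (intro finite_subset [OF _ Z(1)]) auto
    ultimately show False using finite_imageD infinite_UNIV_nat by blast
  qed
  then obtain i0 j0 where ne: "i0 \<noteq> j0" "(F ^^ i0) z = (F ^^ j0) z"
    unfolding inj_def by blast
  define i j where "i = min i0 j0" and "j = max i0 j0"
  have ij: "i < j" "(F ^^ i) z = (F ^^ j) z"
    using ne by (auto simp: i_def j_def min_def max_def)
  have "(F ^^ i) ((F ^^ (j - i)) z) = (F ^^ i) z"
    using ij funpow_add [of i "j - i" F] by simp
  then have per: "j - i > 0 \<and> (F ^^ (j - i)) z = z"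
    using inj_onD [OF inj_iter _ orbit [OF z] z] ij(1) by simp
  define \<kappa> where "\<kappa> = (LEAST k. k > 0 \<and> (F ^^ k) z = z)"
  have "\<kappa> > 0 \<and> (F ^^ \<kappa>) z = z" unfolding \<kappa>_def using per by (rule LeastI)
  moreover have "(F ^^ i) z \<noteq> z" if "0 < i" "i < \<kappa>" for i
    using not_less_Least [of i "\<lambda>k. k > 0 \<and> (F ^^ k) z = z"] that by (auto simp: \<kappa>_def)
  ultimately show thesis using that orbit [OF z] by blast
qed

lemma tendsto_iterate:
  fixes f :: "'a::{nonarch_field,complete_space} fps"
  assumes r: "0 < r" and f: "tate r f" and orbit: "\<And>i. absval ((fps_at f ^^ i) z) \<le> r"
  shows "((fps_at f ^^ i) \<longlongrightarrow> (fps_at f ^^ i) z) (nhds z)"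
proof (induction i)
  case 0
  then show ?case using filterlim_ident [of "nhds z"] by (simp add: id_def)
next
  case (Suc i)
  show ?case using filterlim_compose [OF tendsto_fps_at [OF r f orbit] Suc] by (simp add: comp_def)
qed

lemma eventually_iterate_in_disc:
  fixes f :: "'a::{nonarch_field,complete_space} fps"
  assumes r: "0 < r" and f: "tate r f" and orbit: "\<And>i. absval ((fps_at f ^^ i) z) \<le> r"
  shows "\<forall>\<^sub>F y in nhds z. absval ((fps_at f ^^ i) y) \<le> r"
  using tendsto_iterate [OF assms] eventually_absval_le_nhds [OF orbit r]
  by (rule eventually_compose_filterlim [rotated])

text \<open>
  Differentiability of the iterates in the form of Caratheodory: increments factor through
  \<open>y - z\<close> with a cofactor continuous at \<open>z\<close>. In this form the chain rule is a product of
  cofactors, and the derivative is the value of the cofactor at \<open>z\<close>.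
\<close>

lemma iterate_factorization:
  fixes f :: "'a::{nonarch_field,complete_space} fps"
  assumes r: "0 < r" and f: "tate r f" and orbit: "\<And>i. absval ((fps_at f ^^ i) z) \<le> r"
  shows "\<exists>\<phi>. (\<phi> \<longlongrightarrow> \<phi> z) (nhds z) \<and>
    (\<forall>\<^sub>F y in nhds z. (fps_at f ^^ i) y - (fps_at f ^^ i) z = (y - z) * \<phi> y)"
proof (induction i)
  case 0
  show ?case by (intro exI [of _ "\<lambda>_. 1"]) simp
next
  case (Suc i)
  then obtain \<phi> where \<phi>: "(\<phi> \<longlongrightarrow> \<phi> z) (nhds z)"
    "\<forall>\<^sub>F y in nhds z. (fps_at f ^^ i) y - (fps_at f ^^ i) z = (y - z) * \<phi> y" by blast
  define w where "w = (fps_at f ^^ i) z"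
  have w: "absval w \<le> r" using orbit by (simp add: w_def)
  let ?q = "fps_at (fps_quotient f w)"
  have "((\<lambda>y. \<phi> y * ?q ((fps_at f ^^ i) y)) \<longlongrightarrow> \<phi> z * ?q ((fps_at f ^^ i) z)) (nhds z)"
    using \<phi>(1) filterlim_compose [OF tendsto_fps_at [OF r tate_quotient [OF r f w] orbit]
        tendsto_iterate [OF r f orbit]]
    by (intro tendsto_mult)
  moreover have "\<forall>\<^sub>F y in nhds z. (fps_at f ^^ Suc i) y - (fps_at f ^^ Suc i) z
      = (y - z) * (\<phi> y * ?q ((fps_at f ^^ i) y))"
    using \<phi>(2) eventually_iterate_in_disc [OF r f orbit, of i]
  proof eventually_elim
    case (elim y)
    have "(fps_at f ^^ Suc i) y - (fps_at f ^^ Suc i) z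
        = ((fps_at f ^^ i) y - w) * ?q ((fps_at f ^^ i) y)"
      using fps_at_quotient [OF r f w elim(2)] by (simp add: w_def)
    then show ?case using elim(1) by (simp add: w_def mult.assoc)
  qed
  ultimately show ?case by (intro exI [of _ "\<lambda>y. \<phi> y * ?q ((fps_at f ^^ i) y)"]) blast
qed

lemma eventually_semi_conjugacy_iterate:
  fixes f :: "'a::{nonarch_field,complete_space} fps"
  assumes r: "0 < r" and f: "tate r f" and orbit: "\<And>i. absval ((fps_at f ^^ i) z) \<le> r"
    and semi: "\<And>x. absval x \<le> r \<Longrightarrow> fps_at g (fps_at f x) = \<mu> * fps_at g x"
  shows "\<forall>\<^sub>F y in nhds z. fps_at g ((fps_at f ^^ i) y) = \<mu> ^ i * fps_at g y"
proof (induction i)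
  case (Suc i)
  show ?case
    using Suc eventually_iterate_in_disc [OF r f orbit, of i]
    by eventually_elim (simp add: semi mult.assoc)
qed simp

text \<open>
  Writing \<open>g y = (y - z) ^ m * u y\<close> and \<open>F y - z = (y - z) * \<phi> y\<close> for the iterate \<open>F\<close> of
  \<open>f\<close>, the relation \<open>g (F y) = \<mu> ^ \<kappa> * g y\<close> becomes \<open>\<phi> y ^ m * u (F y) = \<mu> ^ \<kappa> * u y\<close> for
  \<open>y \<noteq> z\<close>, and \<open>y\<close> can tend to \<open>z\<close>. The zero may be multiple, so that only a power of the
  derivative is determined, but this suffices for its absolute value.
\<close>

lemma multiplier_of_conjugacy_zero:
  fixes f g :: "'a::{nonarch_field,complete_space} fps"
  assumes r: "0 < r" and f: "tate r f" and g: "tate r g" "g \<noteq> 0"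
    and semi: "\<And>x. absval x \<le> r \<Longrightarrow> fps_at g (fps_at f x) = \<mu> * fps_at g x"
    and \<mu>: "absval \<mu> = 1"
    and orbit: "\<And>i. absval ((fps_at f ^^ i) z) \<le> r"
    and z: "fps_at g z = 0" "(fps_at f ^^ \<kappa>) z = z"
  obtains d where "has_nonarch_derivative (fps_at f ^^ \<kappa>) d z" "absval d = 1"
proof -
  let ?F = "fps_at f ^^ \<kappa>"
  have zr: "absval z \<le> r" using orbit [of 0] by simp
  obtain \<phi> where \<phi>: "(\<phi> \<longlongrightarrow> \<phi> z) (nhds z)" "\<forall>\<^sub>F y in nhds z. ?F y - ?F z = (y - z) * \<phi> y"
    using iterate_factorization [OF r f orbit] by blast
  obtain m u where u: "tate r u" "fps_at u z \<noteq> 0"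
    "\<And>y. absval y \<le> r \<Longrightarrow> fps_at g y = (y - z) ^ m * fps_at u y"
    using zero_multiplicity [OF r g zr] by blast
  have m: "m > 0" using u(2) u(3) [OF zr] z(1) by (cases m) auto
  have nhds_at: "eventually P (at z)" if "eventually P (nhds z)" for P :: "'a \<Rightarrow> bool"
    using that by (simp add: eventually_at_filter eventually_mono)
  have ne: "\<forall>\<^sub>F y in at z. y \<noteq> z" by (simp add: eventually_at_filter)
  have tendsto_at: "(F \<longlongrightarrow> l) (at z)" if "(F \<longlongrightarrow> l) (nhds z)" for F :: "'a \<Rightarrow> 'a" and l
    using that by (rule filterlim_mono) (auto simp: at_within_le_nhds)
  have quot: "\<forall>\<^sub>F y in at z. (?F y - ?F z) / (y - z) = \<phi> y"
    using nhds_at [OF \<phi>(2)] ne by eventually_elim simp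
  have deriv: "has_nonarch_derivative ?F (\<phi> z) z"
    unfolding has_nonarch_derivative_def tendsto_cong [OF quot] by (rule tendsto_at [OF \<phi>(1)])
  have semi_iter: "\<forall>\<^sub>F y in nhds z. fps_at g (?F y) = \<mu> ^ \<kappa> * fps_at g y"
    by (rule eventually_semi_conjugacy_iterate [OF r f orbit]) (rule semi)
  have eq: "\<forall>\<^sub>F y in at z. \<phi> y ^ m * fps_at u (?F y) = \<mu> ^ \<kappa> * fps_at u y"
    using nhds_at [OF \<phi>(2)] ne nhds_at [OF eventually_iterate_in_disc [OF r f orbit, of \<kappa>]]
      nhds_at [OF semi_iter] nhds_at [OF eventually_absval_le_nhds [OF zr r]]
  proof eventually_elim
    case (elim y)
    have "(y - z) ^ m * (\<phi> y ^ m * fps_at u (?F y)) = (?F y - z) ^ m * fps_at u (?F y)"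
      using elim(1) z(2) by (simp add: power_mult_distrib mult.assoc)
    also have "\<dots> = \<mu> ^ \<kappa> * fps_at g y" using u(3) [OF elim(3)] elim(4) by simp
    also have "\<dots> = (y - z) ^ m * (\<mu> ^ \<kappa> * fps_at u y)" using u(3) [OF elim(5)] by simp
    finally show ?case using elim(2) by simp
  qed
  have "((\<lambda>y. \<phi> y ^ m * fps_at u (?F y)) \<longlongrightarrow> \<phi> z ^ m * fps_at u (?F z)) (at z)"
    using filterlim_compose [OF tendsto_fps_at [OF r u(1) orbit] tendsto_iterate [OF r f orbit]]
    by (intro tendsto_at tendsto_mult tendsto_power_strong tendsto_const \<phi>(1))
  then have lim: "((\<lambda>y. \<mu> ^ \<kappa> * fps_at u y) \<longlongrightarrow> \<phi> z ^ m * fps_at u (?F z)) (at z)"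
    unfolding tendsto_cong [OF eq] .
  have "((\<lambda>y. \<mu> ^ \<kappa> * fps_at u y) \<longlongrightarrow> \<mu> ^ \<kappa> * fps_at u z) (at z)"
    by (intro tendsto_at tendsto_mult tendsto_const tendsto_fps_at [OF r u(1) zr])
  then have "\<phi> z ^ m * fps_at u (?F z) = \<mu> ^ \<kappa> * fps_at u z"
    using tendsto_unique [OF at_neq_bot lim] by simp
  then have "\<phi> z ^ m = \<mu> ^ \<kappa>" using u(2) z(2) by simp
  then have "absval (\<phi> z) ^ m = 1 ^ m" using \<mu> by (metis absval_power power_one)
  then have "absval (\<phi> z) = 1" using m by (metis absval_nonneg power_eq_imp_eq_base zero_le_one)
  then show thesis using that deriv by blast
qed

theorem theorem1:
  fixes f :: "'a::{nonarch_field, complete_space, alg_closed_field} fps"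
    and \<Delta> V :: "'a set" and r :: real and R :: ereal
  assumes "fps_nth f 0 = 0"
    and "absval (fps_nth f 1) = 1"
    and "\<And>n::nat. n > 0 \<Longrightarrow> fps_nth f 1 ^ n \<noteq> 1"
    and "is_linearization_disc f \<Delta>"
    and "r \<in> value_group TYPE('a)"
    and "\<Delta> = ball 0 r"
    and "is_semi_disc f V"
    and "disc_of_radius V R"
    and "R > ereal r"
  shows "\<exists>x \<in> sphere 0 r. indifferent_periodic_point f x"
proof -
  define g where "g = conjugacy_fps f"
  define \<mu> where "\<mu> = fps_nth f 1"
  obtain a :: 'a where a: "a \<noteq> 0" "absval a = r"
    using assms(5) by (auto simp: value_group_def)
  then have r: "0 < r" by (metis absval_pos_iff)
  have nz: "fps_nth f 1 \<noteq> 0" using assms(2) by auto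
  have "\<exists>!g. is_conjugacy_fps f g"
    by (rule ex1_conjugacy_fps [OF assms(1) nz]) (rule assms(3))
  then have "is_conjugacy_fps f g"
    unfolding g_def conjugacy_fps_def by (rule theI')
  then have g01: "fps_nth g 0 = 0" "fps_nth g 1 = 1" by (simp_all add: is_conjugacy_fps_def)
  have "cball 0 r \<subseteq> V"
  proof (cases "V = UNIV")
    case False
    then obtain \<rho> where "R = ereal \<rho>" "V = ball 0 \<rho> \<or> V = cball 0 \<rho>"
      using assms(8) unfolding disc_of_radius_def by blast
    then show ?thesis using assms(9) by fastforce
  qed simp
  then have semi: "semi_conjugacy_on f (cball 0 r)"
    using assms(7) unfolding is_semi_disc_def is_maximal_disc_def semi_conjugacy_on_def Let_def by blast
  have semi': "fps_converges f x" "fps_converges g x"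
    "fps_at g (fps_at f x) = \<mu> * fps_at g x" if "absval x \<le> r" for x
    using semi that unfolding semi_conjugacy_on_def Let_def g_def \<mu>_def
    by (auto simp: mem_cball_0_iff simp del: mem_cball)
  have f: "tate r f" and g: "tate r g"
    using semi'(1,2) [of a] a by (simp_all add: fps_converges_iff_tate)
  have \<mu>: "absval \<mu> = 1" using assms(2) by (simp add: \<mu>_def)
  have inj: "x = y" if "absval x < r" "absval y < r" "fps_at g x = fps_at g y" for x y
    using assms(4,6) that
    unfolding is_linearization_disc_def is_maximal_disc_def full_conjugacy_on_def Let_def g_def
    by (auto simp: inj_on_def mem_ball_0_iff simp del: mem_ball)

  \<comment> \<open>The closed disc is strictly larger than \<open>\<Delta>\<close> because it contains the element \<open>a\<close>.\<close>
  have "\<not> full_conjugacy_on f (cball 0 r)"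
  proof
    assume "full_conjugacy_on f (cball 0 r)"
    moreover have "disc_of_radius (cball (0::'a) r) (ereal r)" using r by (auto simp: disc_of_radius_def)
    ultimately have "cball (0::'a) r \<subseteq> ball 0 r"
      using assms(4,6) unfolding is_linearization_disc_def is_maximal_disc_def by blast
    then have "a \<in> ball 0 r" using a by (auto simp: mem_cball_0_iff simp del: mem_cball mem_ball)
    then show False using a by (simp add: mem_ball_0_iff del: mem_ball)
  qed
  then obtain z where z: "absval z \<le> r" "fps_at g z = 0" "z \<noteq> 0"
    using full_conjugacy_on_cball [OF r semi] g g01 unfolding g_def by blast
  have sphere: "absval z = r" if "absval z \<le> r" "fps_at g z = 0" "z \<noteq> 0" for z
    using inj [of z 0] that g01 r by (force simp: fps_at_0)

  \<comment> \<open>A zero of \<open>f\<close> in the open disc is a zero of \<open>g\<close>, and \<open>g\<close> is injective there.\<close>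
  have "x = 0" if "absval x < r" "fps_at f x = 0" for x
  proof -
    have "\<mu> * fps_at g x = 0" using semi'(3) [of x] that g01 by (simp add: fps_at_0)
    moreover have "\<mu> \<noteq> 0" using \<mu> by auto
    ultimately show ?thesis using inj [of x 0] that g01 r by (simp add: fps_at_0)
  qed
  then have iso: "absval (fps_at f x) = absval x" if "absval x < r" for x
    using absval_fps_at_eq_absval [OF f assms(1,2) _ that] by blast
  define Z where "Z = {x. absval x \<le> r \<and> fps_at g x = 0} - {0}"
  have "g \<noteq> 0" using g01 by auto
  then have "finite Z" unfolding Z_def using finite_zeros [OF r g] by simp
  moreover have "Z \<subseteq> fps_at f ` Z"
  proof
    fix y assume "y \<in> Z"
    then have y: "absval y = r" "fps_at g y = 0" using sphere by (auto simp: Z_def)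
    then obtain x where x: "absval x = r" "fps_at f x = y"
      using sphere_subset_image [OF r f assms(1,2) iso] by blast
    have "\<mu> * fps_at g x = 0" using semi'(3) [of x] x y by simp
    then have "x \<in> Z" using x r \<mu> by (auto simp: Z_def)
    then show "y \<in> fps_at f ` Z" using x(2) by blast
  qed
  moreover have "z \<in> Z" using z by (simp add: Z_def)
  ultimately obtain \<kappa> where \<kappa>: "\<kappa> > 0" "(fps_at f ^^ \<kappa>) z = z"
    "\<And>i. 0 < i \<Longrightarrow> i < \<kappa> \<Longrightarrow> (fps_at f ^^ i) z \<noteq> z" "\<And>i. (fps_at f ^^ i) z \<in> Z"
    by (rule finite_surjective_periodic) blast
  have orbit: "absval ((fps_at f ^^ i) z) \<le> r" for i using \<kappa>(4) [of i] by (simp add: Z_def)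
  obtain d where "has_nonarch_derivative (fps_at f ^^ \<kappa>) d z" "absval d = 1"
    using multiplier_of_conjugacy_zero [OF r f g \<open>g \<noteq> 0\<close> semi'(3) \<mu> orbit z(2) \<kappa>(2)] by blast
  then have "indifferent_periodic_point f z"
    unfolding indifferent_periodic_point_def periodic_point_of_period_def
    using \<kappa> semi'(1) [OF orbit] by blast
  moreover have "z \<in> sphere 0 r"
    using sphere [OF z] by (simp add: mem_sphere_0_iff del: mem_sphere)
  ultimately show ?thesis by blast
qed

end
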